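(* Let $b'\gg(\log n)^3$ and $x_n=\sqrt{2\log n}\,(1+o(1))$. Then $$\lim_{n\to\infty}\frac{\mathbb{P}\left[X+Y-\mathbb{E}(X+Y)>\sqrt{\mathrm{Var}(X+Y)}\;x_n\right]}{1-\Phi(x_n)}=1,$$ where $\Phi(\cdot)$ is the cumulative distribution function of the standard normal distribution.
   Context: $k$ is a fixed positive integer and $\gamma_1,\gamma_2>0$ are constants such that $\gamma_1n/k$ and $\gamma_2n/k$ are integers. $X\sim\mathrm{Bin}(\gamma_1\frac nk,\frac{a'}n)$ and $Y\sim\mathrm{Bin}(\gamma_2\frac nk,\frac{b'}n)$ are independent, where $a'=a'_n\ge b'=b'_n$ and $0<c_0<\liminf\frac{b'}{a'}\le\limsup\frac{b'}{a'}\le1$ for a constant $c_0$. $x_n\gg y_n$ means $x_n/y_n\to\infty$.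
   Formalization: The formal theorem also assumes n − b' ≫ (log n)^3; without it the claim fails, e.g. for a' = b' = n, where X+Y is deterministic and the ratio is 0. *)

theory Defs
  imports "HOL-Probability.Probability" "HOL-Library.Landau_Symbols"
begin

text \<open>
  The sizes \<open>\<gamma>1 n/k\<close> and \<open>\<gamma>2 n/k\<close> have to be integers, so \<open>n\<close> only ranges over the
  following set, and every limit is taken as \<open>n\<close> tends to infinity within it.
\<close>

definition admissible :: "real \<Rightarrow> real \<Rightarrow> nat \<Rightarrow> nat set" where
  "admissible \<gamma>1 \<gamma>2 k =
     {n. 0 < n \<and> \<gamma>1 * real n / real k \<in> \<int> \<and> \<gamma>2 * real n / real k \<in> \<int>}"

definition adm_filter :: "real \<Rightarrow> real \<Rightarrow> nat \<Rightarrow> nat filter" where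
  "adm_filter \<gamma>1 \<gamma>2 k = inf sequentially (principal (admissible \<gamma>1 \<gamma>2 k))"

text \<open>\<open>much_greater F x y\<close> is \<open>x\<^sub>n \<gg> y\<^sub>n\<close> along \<open>F\<close>.\<close>

definition much_greater :: "nat filter \<Rightarrow> (nat \<Rightarrow> real) \<Rightarrow> (nat \<Rightarrow> real) \<Rightarrow> bool" where
  "much_greater F x y \<longleftrightarrow> filterlim (\<lambda>n. x n / y n) at_top F"

end

theory Submission
  imports Defs "HOL-Real_Asymp.Real_Asymp"
begin

text \<open>
  The random variable \<open>X + Y\<close> is a sum of independent Bernoulli variables with variance \<open>V\<close>, and
  the growth conditions say \<open>V \<gg> (ln n)^3\<close>, that is, \<open>x^3 / sqrt V \<rightarrow> 0\<close>. This is the range in which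
  the normal approximation of the tail holds with relative error tending to 0 (Cramer's moderate
  deviations), and the proof follows Cramer's exponential change of measure.

  Put \<open>t = x / sqrt V\<close> and weight the law of the sum by \<open>exp (t k)\<close>. The weighted law is again that
  of a sum of Bernoulli variables (\<open>coeff_bernoulli_gf_tilt\<close>). Its mean is \<open>\<mu> + V t + O(V t^2)\<close>, so
  the threshold \<open>\<mu> + x sqrt V = \<mu> + V t\<close> has become a typical value, and its variance is
  \<open>V (1 + O(t))\<close> (\<open>tilt_mean\<close>, \<open>tilt_variance\<close>). The weights contribute the factor
  \<open>exp (- x^2 / 2 + O(x^3 / sqrt V))\<close> (\<open>bernoulli_cumulant_bound\<close>) and leave the decaying exponential
  \<open>exp (- t (k - m))\<close>, where \<open>m\<close> is the threshold. That exponential lives on the scale \<open>1 / t = sqrt V / x\<close>, much shorter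
  than the standard deviation, and there the tilted probabilities are all close to
  \<open>1 / sqrt (2 \<pi> V)\<close>. Hence the tail is asymptotic to
  \<open>exp (- x^2 / 2) / sqrt (2 \<pi> V) / t = exp (- x^2 / 2) / (x sqrt (2 \<pi>))\<close>, which is also the asymptotic
  value of \<open>1 - \<Phi>(x)\<close> (\<open>mills_ratio_limit\<close>).

  The tilted probabilities are controlled by a local limit theorem with the explicit error
  \<open>50 / V\<close> (\<open>bernoulli_sum_local_limit\<close>), proved by Fourier inversion. As the sum is integer valued,
  only characteristic functions on \<open>[-\<pi>, \<pi>]\<close> enter; over the range of
  the geometric sum the error amounts to \<open>O(1 / (V t))\<close>, which is negligible against the main
  term of order \<open>1 / (t sqrt V)\<close>.
\<close>

section \<open>Generating polynomials of sums of Bernoulli variables\<close>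

text \<open>
  The coefficient of \<open>x^k\<close> is the probability that exactly \<open>k\<close> of the independent trials in
  \<open>I\<close>, with success probabilities \<open>p i\<close>, succeed. Working with a polynomial instead of a
  measure makes the exponential change of measure a mere substitution \<open>x \<mapsto> e^t x\<close>.
\<close>

definition bernoulli_gf :: "'i set \<Rightarrow> ('i \<Rightarrow> real) \<Rightarrow> real poly" where
  "bernoulli_gf I p = (\<Prod>i\<in>I. [:1 - p i, p i:])"

lemma degree_bernoulli_gf: "finite I \<Longrightarrow> degree (bernoulli_gf I p) \<le> card I"
  unfolding bernoulli_gf_def
  by (rule order_trans[OF degree_prod_sum_le])
     (auto intro!: order_trans[OF sum_bounded_above[where K=1]])

lemma coeff_linear_mult:
  "coeff ([:a, b:] * q) j = a * coeff q j + (case j of 0 \<Rightarrow> 0 | Suc i \<Rightarrow> b * coeff q i)"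
  by (auto simp: coeff_pCons split: nat.splits)

lemma coeff_bernoulli_gf_nonneg:
  assumes "finite I" "\<And>i. i \<in> I \<Longrightarrow> 0 \<le> p i \<and> p i \<le> 1"
  shows "0 \<le> coeff (bernoulli_gf I p) j"
  using assms
proof (induction I arbitrary: j rule: finite_induct)
  case (insert i I)
  then show ?case
    by (auto simp: bernoulli_gf_def coeff_linear_mult simp del: mult_pCons_left split: nat.splits
        intro!: add_nonneg_nonneg mult_nonneg_nonneg)
qed (simp add: bernoulli_gf_def)

lemma bernoulli_gf_expand:
  fixes z :: complex
  assumes "finite I" "card I \<le> n"
  shows "(\<Sum>j\<le>n. complex_of_real (coeff (bernoulli_gf I p) j) * z ^ j)
       = (\<Prod>i\<in>I. of_real (1 - p i) + of_real (p i) * z)"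
proof -
  define P where "P = (\<Prod>i\<in>I. [:complex_of_real (1 - p i), complex_of_real (p i):])"
  have c: "coeff P j = complex_of_real (coeff (bernoulli_gf I p) j)" for j
    unfolding P_def using assms(1)
  proof (induction I arbitrary: j rule: finite_induct)
    case (insert i I)
    then show ?case
      by (auto simp: bernoulli_gf_def coeff_linear_mult simp del: mult_pCons_left split: nat.splits)
  qed (simp add: bernoulli_gf_def)
  have "degree P \<le> n"
    using degree_bernoulli_gf[OF assms(1), of p] assms(2) c
    by (metis (no_types, lifting) coeff_eq_0 degree_le dual_order.strict_trans1 of_real_0 order_trans)
  then have "poly P z = (\<Sum>j\<le>n. coeff P j * z ^ j)"
    unfolding poly_altdef by (intro sum.mono_neutral_left) (auto simp: coeff_eq_0)
  moreover have "poly P z = (\<Prod>i\<in>I. of_real (1 - p i) + of_real (p i) * z)"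
    by (simp add: P_def poly_prod mult.commute)
  ultimately show ?thesis by (simp add: c)
qed

section \<open>Fourier inversion and Gaussian integrals\<close>

lemma integral_iexp_period:
  fixes m :: int
  shows "(LINT \<theta>|lborel. indicator {-pi..pi} \<theta> *\<^sub>R iexp (of_int m * \<theta>)) = (if m = 0 then 2 * pi else 0)"
proof (cases "m = 0")
  case False
  have "(LINT \<theta>|lborel. indicator {-pi..pi} \<theta> *\<^sub>R iexp (of_int m * \<theta>))
     = iexp (of_int m * pi) / (\<i> * of_int m) - iexp (of_int m * (-pi)) / (\<i> * of_int m)"
  proof (rule integral_FTC_Icc[where F="\<lambda>\<theta>. iexp (of_int m * \<theta>) / (\<i> * of_int m)"])
    show "continuous_on {-pi..pi} (\<lambda>\<theta>. iexp (of_int m * \<theta>))"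
      by (intro continuous_intros)
    fix x :: real
    have "((\<lambda>z. exp (\<i> * (of_int m * z)) / (\<i> * of_int m)) has_field_derivative iexp (of_int m * x)) (at (of_real x))"
      using False by (auto intro!: derivative_eq_intros simp: field_simps)
    from has_vector_derivative_real_field[OF this]
    show "((\<lambda>x. iexp (of_int m * x) / (\<i> * of_int m)) has_vector_derivative iexp (of_int m * x)) (at x within {- pi..pi})"
      by simp
  qed simp
  also have "iexp (of_int m * pi) = iexp (of_int m * (-pi))"
    using sin_npi_int[of m] by (simp add: complex_eq_iff Re_exp Im_exp mult.commute)
  finally show ?thesis using False by simp
qed (simp add: scaleR_conv_of_real)

text \<open>
  On the unit circle the generating polynomial is the characteristic function of the sum, so a
  single coefficient is recovered by orthogonality of the exponentials.
\<close>

lemma coeff_bernoulli_gf_fourier: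
  assumes "finite I"
  shows "(LINT \<theta>|lborel. indicator {-pi..pi} \<theta> *\<^sub>R
            ((\<Prod>i\<in>I. of_real (1 - p i) + of_real (p i) * iexp \<theta>) * iexp (- (real k * \<theta>))))
        = 2 * pi * coeff (bernoulli_gf I p) k"
proof -
  \<comment> \<open>the range of summation has to contain both the support of the sum and \<open>k\<close>\<close>
  define n where "n = max k (card I)"
  let ?c = "\<lambda>j. complex_of_real (coeff (bernoulli_gf I p) j)"
  have eq: "(\<Prod>i\<in>I. of_real (1 - p i) + of_real (p i) * iexp \<theta>) * iexp (- (real k * \<theta>))
      = (\<Sum>j\<le>n. ?c j * iexp (of_int (int j - int k) * \<theta>))" for \<theta> :: real
  proof -
    have "iexp \<theta> ^ j * iexp (- (real k * \<theta>)) = iexp (of_int (int j - int k) * \<theta>)" for j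
      by (simp add: exp_of_nat_mult[symmetric] exp_add[symmetric] algebra_simps)
    then show ?thesis
      by (subst bernoulli_gf_expand[symmetric, OF assms, of n])
         (simp_all only: n_def sum_distrib_right mult.assoc max.cobounded2)
  qed
  have int: "integrable lborel (\<lambda>\<theta>. indicator {-pi..pi} \<theta> *\<^sub>R iexp (of_int m * \<theta>))" for m
    unfolding set_integrable_def[symmetric]
    by (intro borel_integrable_atLeastAtMost' continuous_intros)
  have "(LINT \<theta>|lborel. indicator {-pi..pi} \<theta> *\<^sub>R
            ((\<Prod>i\<in>I. of_real (1 - p i) + of_real (p i) * iexp \<theta>) * iexp (- (real k * \<theta>))))
      = (LINT \<theta>|lborel. (\<Sum>j\<le>n. ?c j * (indicator {-pi..pi} \<theta> *\<^sub>R iexp (of_int (int j - int k) * \<theta>))))"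
    by (simp only: eq scaleR_sum_right mult_scaleR_right)
  also have "\<dots> = (\<Sum>j\<le>n. ?c j * (LINT \<theta>|lborel. indicator {-pi..pi} \<theta> *\<^sub>R iexp (of_int (int j - int k) * \<theta>)))"
    by (subst Bochner_Integration.integral_sum)
       (rule integrable_mult_right int refl sum.cong integral_mult_right_zero)+
  also have "\<dots> = (\<Sum>j\<le>n. if j = k then ?c j * (2 * pi) else 0)"
    by (intro sum.cong refl, subst integral_iexp_period) auto
  also have "\<dots> = 2 * pi * ?c k"
    by (simp add: n_def)
  finally show ?thesis by simp
qed

text \<open>
  The normal density in the same integral form, so that the local limit theorem becomes a
  comparison of two integrands. This is the characteristic function of the standard normal
  distribution after rescaling, read backwards.
\<close>

lemma normal_density_fourier:
  fixes \<sigma> y :: real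
  assumes "\<sigma> > 0"
  shows "has_bochner_integral lborel (\<lambda>\<theta>. of_real (exp (- (\<sigma>\<^sup>2 * \<theta>\<^sup>2 / 2))) * iexp (- (y * \<theta>)))
           (complex_of_real (2 * pi * normal_density 0 \<sigma> y))"
proof -
  let ?f = "\<lambda>x. std_normal_density x *\<^sub>R iexp (- y / \<sigma> * x)"
  have "char std_normal_distribution (- y / \<sigma>) = (LINT x|lborel. ?f x)"
    unfolding char_def by (subst integral_density) auto
  then have I: "(LINT x|lborel. ?f x) = complex_of_real (exp (- ((y / \<sigma>)\<^sup>2) / 2))"
    unfolding char_std_normal_distribution by simp
  have "integrable lborel ?f"
    by (rule Bochner_Integration.integrable_bound[OF integrable_std_normal_moment[of 0]]) auto
  with I have "has_bochner_integral lborel ?f (complex_of_real (exp (- ((y / \<sigma>)\<^sup>2) / 2)))"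
    by (simp add: has_bochner_integral_iff)
  then have "has_bochner_integral lborel (\<lambda>x. ?f (0 + \<sigma> * x)) 
      (complex_of_real (exp (- ((y / \<sigma>)\<^sup>2) / 2)) /\<^sub>R \<bar>\<sigma>\<bar>)"
    using assms lborel_has_bochner_integral_real_affine_iff[of \<sigma> ?f _ 0] by blast
  then have "has_bochner_integral lborel (\<lambda>x. complex_of_real (sqrt (2 * pi)) * ?f (0 + \<sigma> * x))
     (complex_of_real (sqrt (2 * pi)) * (complex_of_real (exp (- ((y / \<sigma>)\<^sup>2) / 2)) /\<^sub>R \<bar>\<sigma>\<bar>))"
    by (rule has_bochner_integral_mult_right)
  moreover have "complex_of_real (sqrt (2 * pi)) * ?f (0 + \<sigma> * x)
      = of_real (exp (- (\<sigma>\<^sup>2 * x\<^sup>2 / 2))) * iexp (- (y * x))" for x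
    using assms by (simp add: normal_density_def scaleR_conv_of_real real_sqrt_mult power_mult_distrib)
  moreover have "complex_of_real (sqrt (2 * pi)) * (complex_of_real (exp (- ((y / \<sigma>)\<^sup>2) / 2)) /\<^sub>R \<bar>\<sigma>\<bar>)
     = complex_of_real (2 * pi * normal_density 0 \<sigma> y)"
  proof -
    have "sqrt (2 * pi) * (exp (- ((y / \<sigma>)\<^sup>2) / 2) / \<sigma>) = 2 * pi * normal_density 0 \<sigma> y"
      using assms
      by (simp add: normal_density_def real_sqrt_mult power_divide field_simps)
    then show ?thesis using assms
      by (metis abs_of_pos divide_inverse mult.commute of_real_mult scaleR_conv_of_real)
  qed
  ultimately show ?thesis by simp
qed

text \<open>
  The integrated form of the pointwise error bound in the local limit theorem: a third absolute
  moment of a centred normal distribution with variance \<open>6 / V\<close>.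
\<close>

lemma abs_cube_gaussian_integral:
  fixes V :: real
  assumes "V > 0"
  shows "has_bochner_integral lborel (\<lambda>\<theta>. 2 * V * \<bar>\<theta>\<bar> ^ 3 * exp (- (V * \<theta>\<^sup>2 / 12))) (288 / V)"
proof -
  \<comment> \<open>chosen so that \<open>exp (- \<theta>^2 / (2 \<sigma>^2)) = exp (- V \<theta>^2 / 12)\<close>\<close>
  define \<sigma> where "\<sigma> = sqrt (6 / V)"
  have \<sigma>: "\<sigma> > 0" "\<sigma>\<^sup>2 = 6 / V" using assms by (auto simp: \<sigma>_def)
  have "has_bochner_integral lborel (\<lambda>x. normal_density 0 \<sigma> x * \<bar>x - 0\<bar> ^ (2 * 1 + 1))
          (2 ^ 1 * \<sigma> ^ (2 * 1 + 1) * fact 1 * sqrt (2 / pi))"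
    by (rule normal_moment_abs_odd[OF \<sigma>(1)])
  then have "has_bochner_integral lborel (\<lambda>x. (2 * V * sqrt (2 * pi * \<sigma>\<^sup>2)) * (normal_density 0 \<sigma> x * \<bar>x - 0\<bar> ^ (2 * 1 + 1)))
          ((2 * V * sqrt (2 * pi * \<sigma>\<^sup>2)) * (2 ^ 1 * \<sigma> ^ (2 * 1 + 1) * fact 1 * sqrt (2 / pi)))"
    by (rule has_bochner_integral_mult_right)
  moreover have "(2 * V * sqrt (2 * pi * \<sigma>\<^sup>2)) * (normal_density 0 \<sigma> x * \<bar>x - 0\<bar> ^ (2 * 1 + 1))
     = 2 * V * \<bar>x\<bar> ^ 3 * exp (- (V * x\<^sup>2 / 12))" for x
  proof -
    have "sqrt (2 * pi * \<sigma>\<^sup>2) * normal_density 0 \<sigma> x = exp (- (V * x\<^sup>2 / 12))"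
      using \<sigma> assms by (simp add: normal_density_def field_simps)
    then show ?thesis by (simp add: mult_ac eval_nat_numeral)
  qed
  moreover have "(2 * V * sqrt (2 * pi * \<sigma>\<^sup>2)) * (2 ^ 1 * \<sigma> ^ (2 * 1 + 1) * fact 1 * sqrt (2 / pi)) = 288 / V"
  proof -
    have "sqrt (2 * pi * \<sigma>\<^sup>2) * sqrt (2 / pi) = 2 * \<sigma>"
    proof -
      have "sqrt (2 * pi * \<sigma>\<^sup>2) * sqrt (2 / pi) = sqrt ((2 * \<sigma>)\<^sup>2)"
        unfolding real_sqrt_mult[symmetric] by (rule arg_cong[of _ _ sqrt]) (simp add: power2_eq_square)
      also have "\<dots> = 2 * \<sigma>"
        using \<sigma>(1) by (intro real_sqrt_unique) auto
      finally show ?thesis .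
    qed
    then have "(2 * V * sqrt (2 * pi * \<sigma>\<^sup>2)) * (2 ^ 1 * \<sigma> ^ (2 * 1 + 1) * fact 1 * sqrt (2 / pi))
        = 2 * V * (2 * \<sigma> ^ 3) * (2 * \<sigma>)"
      by (simp add: mult_ac eval_nat_numeral)
    also have "\<dots> = 8 * V * (\<sigma>\<^sup>2)\<^sup>2" by (simp add: eval_nat_numeral)
    also have "\<dots> = 288 / V" unfolding \<sigma>(2) using assms by (simp add: power2_eq_square)
    finally show ?thesis .
  qed
  ultimately show ?thesis by (simp only:)
qed

section \<open>A local limit theorem for sums of Bernoulli variables\<close>

text \<open>
  A quadratic lower bound on the whole period, which is what keeps the characteristic function of
  an integer-valued sum under control up to \<open>\<plusminus>\<pi>\<close>. It follows from the Taylor bound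
  \<open>cos \<theta> \<le> 1 - \<theta>^2/2 + \<theta>^4/24\<close> because \<open>\<pi>^2 \<le> 10\<close>.
\<close>

lemma one_minus_cos_ge:
  fixes \<theta> :: real
  assumes "\<bar>\<theta>\<bar> \<le> pi"
  shows "\<theta>\<^sup>2 / 12 \<le> 1 - cos \<theta>"
proof -
  have "cmod (iexp \<theta> - (\<Sum>k\<le>3. (\<i> * \<theta>)^k / fact k)) \<le> \<bar>\<theta>\<bar>^(Suc 3) / fact (Suc 3)"
    by (rule iexp_approx1)
  from order_trans[OF abs_Re_le_cmod this]
  have A: "\<bar>Re (iexp \<theta> - (\<Sum>k\<le>3. (\<i> * \<theta>)^k / fact k))\<bar> \<le> \<bar>\<theta>\<bar>^4 / 24"
    by (simp add: fact_numeral)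
  have B: "Re (iexp \<theta> - (\<Sum>k\<le>3. (\<i> * \<theta>)^k / fact k)) = cos \<theta> - (1 - \<theta>\<^sup>2 / 2)"
    by (simp add: eval_nat_numeral Re_exp)
  from A[unfolded B] have "cos \<theta> \<le> 1 - \<theta>\<^sup>2 / 2 + \<theta>^4 / 24"
    unfolding abs_le_iff by simp
  moreover have "\<theta>\<^sup>2 \<le> 10"
  proof -
    have "\<theta>\<^sup>2 \<le> pi\<^sup>2" using assms abs_le_square_iff by fastforce
    also have "\<dots> \<le> (3.15)\<^sup>2" using pi_approx by (intro power_mono) auto
    finally show ?thesis by (simp add: power2_eq_square)
  qed
  then have "\<theta>\<^sup>2 * \<theta>\<^sup>2 \<le> 10 * \<theta>\<^sup>2" by (intro mult_right_mono) auto
  then have "\<theta>^4 \<le> 10 * \<theta>\<^sup>2" by (simp add: eval_nat_numeral)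
  ultimately show ?thesis by simp
qed

definition centred_char :: "real \<Rightarrow> real \<Rightarrow> complex" where
  "centred_char p \<theta> = of_real (1 - p) * iexp (- (p * \<theta>)) + of_real p * iexp ((1 - p) * \<theta>)"

lemma centred_char_eq:
  "(of_real (1 - p) + of_real p * iexp \<theta>) = centred_char p \<theta> * iexp (p * \<theta>)"
proof -
  have "iexp (- (p * \<theta>)) * iexp (p * \<theta>) = 1" "iexp ((1 - p) * \<theta>) * iexp (p * \<theta>) = iexp \<theta>"
    unfolding exp_add[symmetric] by (simp_all add: algebra_simps)
  then show ?thesis by (simp add: centred_char_def distrib_right mult.assoc)
qed

text \<open>
  The squared modulus equals \<open>1 - 2 p (1 - p) (1 - cos \<theta>)\<close>.
\<close>

lemma norm_centred_char_le:
  assumes "0 \<le> p" "p \<le> 1" "\<bar>\<theta>\<bar> \<le> pi"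
  shows "norm (centred_char p \<theta>) \<le> exp (- (p * (1 - p) * \<theta>\<^sup>2 / 12))"
proof -
  have "norm (centred_char p \<theta>) = norm (of_real (1 - p) + of_real p * iexp \<theta>)"
    unfolding centred_char_eq by (simp add: norm_mult)
  then have "(norm (centred_char p \<theta>))\<^sup>2 = (1 - p + p * cos \<theta>)\<^sup>2 + (p * sin \<theta>)\<^sup>2"
    by (simp add: cmod_power2 Re_exp Im_exp)
  also have "\<dots> = (1 - p)\<^sup>2 + 2 * p * (1 - p) * cos \<theta> + p\<^sup>2 * ((sin \<theta>)\<^sup>2 + (cos \<theta>)\<^sup>2)"
    by algebra
  also have "\<dots> = 1 - 2 * (p * (1 - p)) * (1 - cos \<theta>)"
    unfolding sin_cos_squared_add by (simp add: power2_eq_square algebra_simps)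
  also have "\<dots> \<le> 1 - 2 * (p * (1 - p)) * (\<theta>\<^sup>2 / 12)"
    using mult_left_mono[OF one_minus_cos_ge[OF assms(3)], of "2 * (p * (1 - p))"] assms by simp
  also have "\<dots> \<le> exp (- (2 * (p * (1 - p)) * (\<theta>\<^sup>2 / 12)))"
    using exp_ge_add_one_self[of "- (2 * (p * (1 - p)) * (\<theta>\<^sup>2 / 12))"] by simp
  also have "\<dots> = (exp (- (p * (1 - p) * \<theta>\<^sup>2 / 12)))\<^sup>2"
    unfolding exp_double[symmetric] by simp
  finally show ?thesis
    by (rule power2_le_imp_le) simp
qed

lemma bernoulli_var_le: "p * (1 - p) \<le> 1 / 4" for p :: real
  using zero_le_power2[of "p - 1/2"] by (simp add: power2_eq_square algebra_simps)

text \<open>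
  Both functions are \<open>1 - p (1 - p) \<theta>^2 / 2\<close> up to third order: a centred variable has no linear
  term, and its third absolute moment is at most its variance since it is bounded by 1. The
  factor \<open>p (1 - p)\<close> in the error is essential, because after summation over the trials it
  yields the variance of the sum.
\<close>

lemma centred_char_gaussian_approx:
  assumes p: "0 \<le> p" "p \<le> 1" and \<theta>: "\<bar>\<theta>\<bar> \<le> pi"
  shows "norm (centred_char p \<theta> - of_real (exp (- (p * (1 - p) * \<theta>\<^sup>2 / 2)))) \<le> p * (1 - p) * \<bar>\<theta>\<bar>^3"
proof -
  define v where "v = p * (1 - p)"
  have v: "0 \<le> v" "v \<le> 1/4" using p bernoulli_var_le by (auto simp: v_def)
  \<comment> \<open>the second-order Taylor remainder of the exponential on the imaginary axis\<close>
  define R where "R = (\<lambda>x. iexp x - (1 + \<i> * complex_of_real x - (complex_of_real x)\<^sup>2 / 2))"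
  have R: "norm (R x) \<le> \<bar>x\<bar>^3 / 6" for x
  proof -
    have "(\<Sum>k\<le>2. (\<i> * complex_of_real x)^k / fact k) = 1 + \<i> * complex_of_real x - (complex_of_real x)\<^sup>2 / 2"
    proof -
      have "{..2::nat} = {0, 1, 2}" by auto
      then show ?thesis by (simp add: power_mult_distrib)
    qed
    from iexp_approx1[of x 2, unfolded this] show ?thesis
      by (simp add: R_def fact_numeral)
  qed
  define s where "s = 1 - p"
  have s: "0 \<le> s" "v = p * s" "p + s = 1" using p by (auto simp: s_def v_def)
  have "centred_char p \<theta> - (1 - of_real (v * \<theta>\<^sup>2 / 2))
      = of_real s * R (- (p * \<theta>)) + of_real p * R (s * \<theta>)"
  proof -
    define c d T where "c = complex_of_real p" and "d = complex_of_real s" and "T = complex_of_real \<theta>"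
    have cd: "c + d = 1" using s(3) unfolding c_def d_def of_real_add[symmetric] by simp
    have "d * (1 + \<i> * (- (c * T)) - (- (c * T))\<^sup>2 / 2) + c * (1 + \<i> * (d * T) - (d * T)\<^sup>2 / 2)
       = (c + d) - c * d * (c + d) * T\<^sup>2 / 2"
      by (simp add: field_simps power2_eq_square)
    then have X: "1 - c * d * T\<^sup>2 / 2
      = d * (1 + \<i> * (- (c * T)) - (- (c * T))\<^sup>2 / 2) + c * (1 + \<i> * (d * T) - (d * T)\<^sup>2 / 2)"
      unfolding cd by simp
    have distrib: "d * e + c * e' - (d * f + c * f') = d * (e - f) + c * (e' - f')" for e e' f f'
      by (simp add: algebra_simps)
    have "1 - complex_of_real (v * \<theta>\<^sup>2 / 2) = 1 - c * d * T\<^sup>2 / 2"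
      by (simp add: s(2) c_def d_def T_def)
    moreover have "centred_char p \<theta> = d * iexp (- (p * \<theta>)) + c * iexp (s * \<theta>)"
      by (simp add: centred_char_def c_def d_def s_def)
    moreover have "R (- (p * \<theta>)) = iexp (- (p * \<theta>)) - (1 + \<i> * (- (c * T)) - (- (c * T))\<^sup>2 / 2)"
      "R (s * \<theta>) = iexp (s * \<theta>) - (1 + \<i> * (d * T) - (d * T)\<^sup>2 / 2)"
      unfolding R_def by (simp_all only: c_def d_def T_def of_real_minus of_real_mult)
    ultimately show ?thesis
      unfolding X c_def[symmetric] d_def[symmetric] by (simp only: distrib)
  qed
  also have "norm \<dots> \<le> norm (of_real s * R (- (p * \<theta>))) + norm (of_real p * R (s * \<theta>))"
    by (rule norm_triangle_ineq)
  also have "\<dots> = s * norm (R (- (p * \<theta>))) + p * norm (R (s * \<theta>))"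
    using p s by (simp add: norm_mult)
  also have "\<dots> \<le> s * (\<bar>- (p * \<theta>)\<bar>^3 / 6) + p * (\<bar>s * \<theta>\<bar>^3 / 6)"
    using p s by (intro add_mono mult_left_mono R) 
  also have "\<dots> = v * (p\<^sup>2 + s\<^sup>2) * \<bar>\<theta>\<bar>^3 / 6"
  proof -
    have "s * ((p * T) ^ 3 / 6) + p * ((s * T) ^ 3 / 6) = p * s * (p\<^sup>2 + s\<^sup>2) * T ^ 3 / 6" for T :: real
      by (simp add: field_simps power2_eq_square power3_eq_cube)
    then show ?thesis using p(1) s(1) unfolding s(2) by (simp add: abs_mult)
  qed
  also have "\<dots> \<le> v * 1 * \<bar>\<theta>\<bar>^3 / 6"
  proof -
    have "p\<^sup>2 + s\<^sup>2 = 1 - 2 * v" by (simp add: v_def s_def power2_eq_square algebra_simps)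
    then show ?thesis using v by (intro divide_right_mono mult_right_mono mult_left_mono) auto
  qed
  finally have 1: "norm (centred_char p \<theta> - (1 - of_real (v * \<theta>\<^sup>2 / 2))) \<le> v * \<bar>\<theta>\<bar>^3 / 6" by simp
  have ew: "\<bar>(1 - w) - exp (- w)\<bar> \<le> w\<^sup>2 / 2" if "0 \<le> w" for w :: real
  proof -
    have "1 \<le> (1 + w + w\<^sup>2 / 2) * (1 - w + w\<^sup>2 / 2)"
      using zero_le_power2[of "w * w"] by (simp add: power2_eq_square algebra_simps)
    also have "\<dots> \<le> exp w * (1 - w + w\<^sup>2 / 2)"
      using exp_lower_Taylor_quadratic[OF that] zero_le_power2[of "w - 1"]
      by (intro mult_right_mono) (auto simp: power2_eq_square algebra_simps)
    finally have "exp (- w) \<le> 1 - w + w\<^sup>2 / 2"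
      by (simp add: exp_minus field_simps)
    then show ?thesis using exp_ge_add_one_self[of "- w"] by simp
  qed
  have "norm ((1 - of_real (v * \<theta>\<^sup>2 / 2)) - complex_of_real (exp (- (v * \<theta>\<^sup>2 / 2))))
      = \<bar>(1 - v * \<theta>\<^sup>2 / 2) - exp (- (v * \<theta>\<^sup>2 / 2))\<bar>"
    unfolding norm_of_real[symmetric, where ?'a=complex] by simp
  also have "\<dots> \<le> (v * \<theta>\<^sup>2 / 2)\<^sup>2 / 2" using v by (intro ew) auto
  also have "\<dots> = v * \<bar>\<theta>\<bar>^3 * (v * \<bar>\<theta>\<bar> / 8)"
  proof -
    have "(v * T\<^sup>2 / 2)\<^sup>2 / 2 = v * T^3 * (v * T / 8)" for T
      by (simp add: power2_eq_square power3_eq_cube)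
    from this[of "\<bar>\<theta>\<bar>"] show ?thesis by simp
  qed
  also have "\<dots> \<le> v * \<bar>\<theta>\<bar>^3 * (1/4 * 4 / 8)"
    using v \<theta> pi_less_4 by (intro mult_left_mono divide_right_mono mult_mono) auto
  finally have 2: "norm ((1 - of_real (v * \<theta>\<^sup>2 / 2)) - complex_of_real (exp (- (v * \<theta>\<^sup>2 / 2)))) \<le> v * \<bar>\<theta>\<bar>^3 / 8"
    by simp
  have "norm (centred_char p \<theta> - of_real (exp (- (v * \<theta>\<^sup>2 / 2)))) \<le> v * \<bar>\<theta>\<bar>^3 / 6 + v * \<bar>\<theta>\<bar>^3 / 8"
    by (rule norm_diff_triangle_le[OF 1 2])
  also have "\<dots> \<le> v * \<bar>\<theta>\<bar>^3" using v by (simp add: field_simps)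
  finally show ?thesis by (simp add: v_def)
qed

text \<open>
  A telescoping comparison of products whose factors all decay like \<open>exp (- v i a)\<close>. Replacing
  one factor costs \<open>v i b\<close> and gives up the decay of this factor only, at most \<open>exp (a / 4)\<close>
  since a Bernoulli variance is at most \<open>1 / 4\<close>.
\<close>

lemma norm_prod_diff_exp_le:
  fixes f g :: "'i \<Rightarrow> complex" and v :: "'i \<Rightarrow> real"
  assumes "finite I" "0 \<le> a" "0 \<le> b"
    and "\<And>i. i \<in> I \<Longrightarrow> 0 \<le> v i \<and> v i \<le> 1 / 4"
    and "\<And>i. i \<in> I \<Longrightarrow> norm (f i) \<le> exp (- (v i * a))"
    and "\<And>i. i \<in> I \<Longrightarrow> norm (g i) \<le> exp (- (v i * a))"
    and "\<And>i. i \<in> I \<Longrightarrow> norm (f i - g i) \<le> v i * b"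
  shows "norm (prod f I - prod g I) \<le> exp (a / 4) * (sum v I * b) * exp (- (sum v I * a))"
  using assms
proof (induction I rule: finite_induct)
  case (insert i I)
  let ?V = "sum v I"
  have V: "0 \<le> ?V" using insert by (intro sum_nonneg) auto
  have IH: "norm (prod f I - prod g I) \<le> exp (a / 4) * (?V * b) * exp (- (?V * a))"
    using insert by (intro insert.IH) auto
  have "prod f (insert i I) - prod g (insert i I)
      = f i * (prod f I - prod g I) + (f i - g i) * prod g I"
    using insert(1,2) by (simp add: algebra_simps)
  also have "norm \<dots> \<le> norm (f i) * norm (prod f I - prod g I) + norm (f i - g i) * norm (prod g I)"
    by (rule order_trans[OF norm_triangle_ineq]) (simp add: norm_mult)
  also have "norm (f i) * norm (prod f I - prod g I)
       \<le> exp (- (v i * a)) * (exp (a / 4) * (?V * b) * exp (- (?V * a)))"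
    using insert IH by (intro mult_mono) auto
  also have "norm (f i - g i) * norm (prod g I) \<le> (v i * b) * exp (- (?V * a))"
  proof -
    have "norm (prod g I) \<le> (\<Prod>i\<in>I. exp (- (v i * a)))"
      unfolding prod_norm[symmetric] using insert by (intro prod_mono) auto
    also have "\<dots> = exp (- (?V * a))"
      using insert(1) by (simp add: exp_sum[symmetric] sum_negf sum_distrib_right)
    finally show ?thesis using insert by (intro mult_mono) auto
  qed
  also have "(v i * b) * exp (- (?V * a)) \<le> (v i * b) * (exp (a / 4) * exp (- (v i * a)) * exp (- (?V * a)))"
  proof -
    have "v i * a \<le> 1 / 4 * a" using insert by (intro mult_right_mono) auto
    then have "1 \<le> exp (a / 4) * exp (- (v i * a))"
      by (simp add: exp_add[symmetric])
    then have "1 * exp (- (?V * a)) \<le> exp (a / 4) * exp (- (v i * a)) * exp (- (?V * a))"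
      by (intro mult_right_mono) auto
    then show ?thesis using insert by (intro mult_left_mono) auto
  qed
  also have "exp (- (v i * a)) * (exp (a / 4) * (?V * b) * exp (- (?V * a)))
       + (v i * b) * (exp (a / 4) * exp (- (v i * a)) * exp (- (?V * a)))
     = exp (a / 4) * ((v i + ?V) * b) * (exp (- (v i * a)) * exp (- (?V * a)))"
    by (simp add: algebra_simps)
  also have "exp (- (v i * a)) * exp (- (?V * a)) = exp (- ((v i + ?V) * a))"
    by (simp add: exp_add[symmetric] algebra_simps)
  finally show ?case using insert(1,2) by simp
qed simp

text \<open>
  Local limit theorem with an error of order \<open>1 / V\<close>, uniformly in \<open>k\<close> and in the success
  probabilities. Both sides are Fourier integrals; the integrands differ by at most
  \<open>2 V |\<theta>|^3 exp (- V \<theta>^2 / 12)\<close>, on \<open>[-\<pi>, \<pi>]\<close> by the product comparison and outside because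
  only the Gaussian integrand is left there.
\<close>

theorem bernoulli_sum_local_limit:
  assumes "finite I" and p: "\<And>i. i \<in> I \<Longrightarrow> 0 \<le> p i \<and> p i \<le> 1"
    and V_def: "V = (\<Sum>i\<in>I. p i * (1 - p i))" and "1 \<le> V"
  shows "\<bar>coeff (bernoulli_gf I p) k - normal_density (\<Sum>i\<in>I. p i) (sqrt V) (real k)\<bar> \<le> 50 / V"
proof -
  define \<mu> where "\<mu> = (\<Sum>i\<in>I. p i)"
  define y where "y = real k - \<mu>"
  have V: "V > 0" "(sqrt V)\<^sup>2 = V" using \<open>1 \<le> V\<close> by auto
  define h where "h = (\<lambda>\<theta>. \<Prod>i\<in>I. centred_char (p i) \<theta>)"
  define A where "A = (\<lambda>\<theta>::real. indicator {-pi..pi} \<theta> *\<^sub>R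
            ((\<Prod>i\<in>I. of_real (1 - p i) + of_real (p i) * iexp \<theta>) * iexp (- (real k * \<theta>))))"
  define B where "B = (\<lambda>\<theta>::real. of_real (exp (- (V * \<theta>\<^sup>2 / 2))) * iexp (- (y * \<theta>)))"
  have A_eq: "A \<theta> = indicator {-pi..pi} \<theta> *\<^sub>R (h \<theta> * iexp (- (y * \<theta>)))" for \<theta>
  proof -
    have "(\<Prod>i\<in>I. iexp (p i * \<theta>)) = iexp (\<mu> * \<theta>)"
      using \<open>finite I\<close> by (simp add: exp_sum[symmetric] \<mu>_def sum_distrib_left sum_distrib_right)
    then show ?thesis
      unfolding A_def h_def centred_char_eq prod.distrib y_def
      by (simp add: mult.assoc left_diff_distrib right_diff_distrib flip: exp_add)
  qed
  have bound: "norm (A \<theta> - B \<theta>) \<le> 2 * V * \<bar>\<theta>\<bar> ^ 3 * exp (- (V * \<theta>\<^sup>2 / 12))" for \<theta>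
  proof (cases "\<bar>\<theta>\<bar> \<le> pi")
    case True
    have "A \<theta> - B \<theta> = (h \<theta> - of_real (exp (- (V * \<theta>\<^sup>2 / 2)))) * iexp (- (y * \<theta>))"
      using True by (simp add: A_eq B_def left_diff_distrib abs_le_iff indicator_def)
    then have "norm (A \<theta> - B \<theta>) = norm (h \<theta> - of_real (exp (- (V * \<theta>\<^sup>2 / 2))))"
      by (simp add: norm_mult)
    also have "complex_of_real (exp (- (V * \<theta>\<^sup>2 / 2))) 
        = (\<Prod>i\<in>I. of_real (exp (- (p i * (1 - p i) * \<theta>\<^sup>2 / 2))))"
      using \<open>finite I\<close> unfolding of_real_prod[symmetric] 
      by (simp add: exp_sum[symmetric] V_def sum_negf sum_distrib_right sum_divide_distrib)
    also have "norm (h \<theta> - \<dots>) \<le> exp (\<theta>\<^sup>2 / 12 / 4) * (V * \<bar>\<theta>\<bar> ^ 3) * exp (- (V * (\<theta>\<^sup>2 / 12)))"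
      unfolding h_def V_def using p True bernoulli_var_le
      by (intro norm_prod_diff_exp_le \<open>finite I\<close>) 
         (auto intro!: centred_char_gaussian_approx order_trans[OF norm_centred_char_le]
            mult_left_mono)
    also have "exp (\<theta>\<^sup>2 / 12 / 4) \<le> 2"
    proof -
      have "\<theta>\<^sup>2 \<le> pi\<^sup>2" using True abs_le_square_iff by fastforce
      also have "\<dots> \<le> 4\<^sup>2" using pi_less_4 by (intro power_mono) auto
      finally have "exp (\<theta>\<^sup>2 / 12 / 4) \<le> exp (1 / 2)" by simp
      also have "\<dots> \<le> (2::real)" by (rule exp_half_le2)
      finally show ?thesis .
    qed
    finally show ?thesis using V by (simp add: mult_right_mono mult.assoc)
  next
    case False
    have "indicator {-pi..pi} \<theta> = (0::real)" using False by (auto simp: indicator_def)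
    then have "norm (A \<theta> - B \<theta>) = exp (- (V * \<theta>\<^sup>2 / 2))"
      by (simp add: A_def B_def norm_mult)
    also have "\<dots> \<le> 1 * exp (- (V * \<theta>\<^sup>2 / 12))"
      using V by simp
    also have "\<dots> \<le> (2 * V * \<bar>\<theta>\<bar> ^ 3) * exp (- (V * \<theta>\<^sup>2 / 12))"
    proof (rule mult_right_mono)
      have "1 ^ 3 \<le> \<bar>\<theta>\<bar> ^ 3" using False pi_gt3 by (intro power_mono) auto
      then have "1 * 1 \<le> (2 * V) * \<bar>\<theta>\<bar> ^ 3" using \<open>1 \<le> V\<close> by (intro mult_mono) auto
      then show "1 \<le> 2 * V * \<bar>\<theta>\<bar> ^ 3" by simp
    qed simp
    finally show ?thesis .
  qed
  have B: "has_bochner_integral lborel B (complex_of_real (2 * pi * normal_density 0 (sqrt V) y))"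
    using normal_density_fourier[of "sqrt V" y] V unfolding B_def by simp
  have A: "integrable lborel A"
    unfolding A_def set_integrable_def[symmetric]
    by (intro borel_integrable_atLeastAtMost' continuous_intros)
  note G = abs_cube_gaussian_integral[OF V(1)]
  have "2 * pi * \<bar>coeff (bernoulli_gf I p) k - normal_density \<mu> (sqrt V) (real k)\<bar>
      = norm (complex_of_real (2 * pi * coeff (bernoulli_gf I p) k) - complex_of_real (2 * pi * normal_density 0 (sqrt V) y))"
  proof -
    have "normal_density \<mu> (sqrt V) (real k) = normal_density 0 (sqrt V) y"
      by (simp add: normal_density_def y_def)
    then show ?thesis
      unfolding of_real_diff[symmetric] norm_of_real right_diff_distrib[symmetric] abs_mult by simp
  qed
  also have "\<dots> = norm ((LINT \<theta>|lborel. A \<theta>) - (LINT \<theta>|lborel. B \<theta>))"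
    using coeff_bernoulli_gf_fourier[OF \<open>finite I\<close>, of p k] B
    by (simp add: A_def has_bochner_integral_integral_eq)
  also have "\<dots> = norm (LINT \<theta>|lborel. A \<theta> - B \<theta>)"
    using A B by (simp add: has_bochner_integral_iff)
  also have "\<dots> \<le> (LINT \<theta>|lborel. 2 * V * \<bar>\<theta>\<bar> ^ 3 * exp (- (V * \<theta>\<^sup>2 / 12)))"
    using A B G bound
    by (intro order_trans[OF integral_norm_bound] integral_mono) (auto simp: has_bochner_integral_iff)
  also have "\<dots> = 288 / V"
    using G by (simp add: has_bochner_integral_iff)
  finally have "\<bar>coeff (bernoulli_gf I p) k - normal_density \<mu> (sqrt V) (real k)\<bar> \<le> 288 / V / (2 * pi)"
    by (simp only: pos_le_divide_eq mult.commute pi_gt_zero zero_less_mult_iff zero_less_numeral simp_thms)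
  also have "\<dots> \<le> 50 / V"
    using V pi_gt3 by (simp add: field_simps)
  finally show ?thesis by (simp add: \<mu>_def)
qed

section \<open>The exponential change of measure\<close>

text \<open>
  Weighting the outcome 1 of a Bernoulli variable by \<open>exp t\<close> and renormalising gives a Bernoulli
  variable with this success probability.
\<close>

definition tilt :: "real \<Rightarrow> real \<Rightarrow> real" where
  "tilt t p = p * exp t / (1 - p + p * exp t)"

lemma tilt_denominator_ge_1:
  fixes p t :: real
  assumes "0 \<le> p" "0 \<le> t"
  shows "1 \<le> 1 - p + p * exp t"
  using mult_left_mono[of 1 "exp t" p] assms by simp

lemma tilt_bounds:
  assumes "0 \<le> p" "p \<le> 1" "0 \<le> t"
  shows "0 \<le> tilt t p" "tilt t p \<le> 1"
  using tilt_denominator_ge_1[of p t] assms by (auto simp: tilt_def divide_simps)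

text \<open>
  Weighting the law of the sum by \<open>exp (t k)\<close> acts on each trial separately, so the tilted law is
  again that of a sum of Bernoulli variables; the normalising factor is the exponential of the
  cumulant generating function at \<open>t\<close>.
\<close>

lemma coeff_bernoulli_gf_tilt:
  assumes "finite I" "\<And>i. i \<in> I \<Longrightarrow> 0 \<le> p i" "0 \<le> t"
  shows "coeff (bernoulli_gf I p) k
       = exp ((\<Sum>i\<in>I. ln (1 - p i + p i * exp t)) - t * real k) * coeff (bernoulli_gf I (\<lambda>i. tilt t (p i))) k"
proof -
  define D where "D = (\<lambda>i. 1 - p i + p i * exp t)"
  have D: "D i > 0" if "i \<in> I" for i
    using tilt_denominator_ge_1[of "p i" t] assms that by (auto simp: D_def)
  have "pcompose (bernoulli_gf I p) [:0, exp t:] = (\<Prod>i\<in>I. [:1 - p i, p i * exp t:])"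
    by (simp add: bernoulli_gf_def pcompose_prod pcompose_pCons mult.commute)
  also have "\<dots> = (\<Prod>i\<in>I. smult (D i) [:1 - tilt t (p i), tilt t (p i):])"
  proof (rule prod.cong[OF refl])
    fix i assume "i \<in> I"
    then have "D i * (1 - tilt t (p i)) = 1 - p i" "D i * tilt t (p i) = p i * exp t"
      using D[of i] unfolding tilt_def D_def by (simp_all add: right_diff_distrib)
    then show "[:1 - p i, p i * exp t:] = smult (D i) [:1 - tilt t (p i), tilt t (p i):]" by simp
  qed
  also have "\<dots> = smult (\<Prod>i\<in>I. D i) (bernoulli_gf I (\<lambda>i. tilt t (p i)))"
    unfolding bernoulli_gf_def by (rule prod_smult)
  also have "(\<Prod>i\<in>I. D i) = exp (\<Sum>i\<in>I. ln (D i))"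
    using assms(1) D by (simp add: exp_sum)
  finally have "exp t ^ k * coeff (bernoulli_gf I p) k
      = exp (\<Sum>i\<in>I. ln (D i)) * coeff (bernoulli_gf I (\<lambda>i. tilt t (p i))) k"
    by (metis coeff_pcompose_linear coeff_smult)
  then show ?thesis
    by (simp add: D_def exp_diff exp_of_nat2_mult[symmetric] field_simps)
qed

text \<open>
  With \<open>s = exp t - 1\<close> and \<open>d = 1 + p s\<close> one has \<open>tilt t p - p = p (1 - p) s / d\<close> and
  \<open>tilt t p (1 - tilt t p) = p (1 - p) (1 + s) / d^2\<close>. Thus the tilt moves the mean by variance
  times \<open>t\<close> to first order and hardly changes the variance, with errors proportional to the
  variance.
\<close>

lemma
  fixes p t :: real
  assumes p: "0 \<le> p" "p \<le> 1" and t: "0 \<le> t" "t \<le> 1"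
  shows tilt_mean: "\<bar>tilt t p - p - p * (1 - p) * t\<bar> \<le> p * (1 - p) * (4 * t\<^sup>2)"
    and tilt_variance: "\<bar>tilt t p * (1 - tilt t p) - p * (1 - p)\<bar> \<le> p * (1 - p) * (2 * t)"
proof -
  define s where "s = exp t - 1"
  have s: "t \<le> s" "s \<le> t + t\<^sup>2"
    using exp_ge_add_one_self[of t] exp_bound[OF t] by (simp_all add: s_def del: exp_ge_add_one_self)
  have "t\<^sup>2 \<le> t" using mult_left_mono[of t 1 t] t by (simp add: power2_eq_square)
  then have s2: "0 \<le> s" "s \<le> 2 * t" using s t by auto
  define d where "d = 1 + p * s"
  have ps: "0 \<le> p * s" "p * s \<le> s" using p s2 mult_right_mono[of p 1 s] by auto
  then have d: "1 \<le> d" "d \<le> 1 + s" by (auto simp: d_def)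
  have tilt: "tilt t p = p * (1 + s) / d"
    by (simp add: tilt_def d_def s_def algebra_simps)
  have 1: "1 - tilt t p = (1 - p) / d"
    using d unfolding tilt by (simp add: divide_simps) (simp add: d_def algebra_simps)
  have v: "0 \<le> p * (1 - p)" using p by simp
  have "tilt t p - p - p * (1 - p) * t = p * (1 - p) * (s / d - t)"
    using d unfolding tilt by (simp add: divide_simps) (simp add: d_def algebra_simps)
  moreover have "\<bar>s / d - t\<bar> \<le> 4 * t\<^sup>2"
  proof -
    have "s / d \<le> s" using d s2 by (simp add: divide_simps mult_le_cancel_left1)
    moreover have "s - s\<^sup>2 \<le> s / d"
    proof -
      have "s - s / d = s * (p * s) / d" using d by (simp add: divide_simps) (simp add: d_def algebra_simps)
      also have "\<dots> \<le> s * s / 1" using d ps s2 by (intro frac_le mult_left_mono mult_nonneg_nonneg) auto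
      finally show ?thesis by (simp add: power2_eq_square)
    qed
    moreover have "s\<^sup>2 \<le> (2 * t)\<^sup>2" using s2 by (intro power_mono) auto
    then have "s\<^sup>2 \<le> 4 * t\<^sup>2" by (simp add: power_mult_distrib)
    ultimately show ?thesis using s s2 t by (auto simp: abs_le_iff)
  qed
  ultimately show "\<bar>tilt t p - p - p * (1 - p) * t\<bar> \<le> p * (1 - p) * (4 * t\<^sup>2)"
    using v by (simp only: abs_mult[of "p * (1 - p)"] abs_of_nonneg[OF v]) (rule mult_left_mono)
  have "tilt t p * (1 - tilt t p) - p * (1 - p) = p * (1 - p) * ((1 + s) / d\<^sup>2 - 1)"
    using d unfolding 1 by (simp add: tilt power2_eq_square algebra_simps)
  moreover have "\<bar>(1 + s) / d\<^sup>2 - 1\<bar> \<le> 2 * t"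
  proof -
    have "(1 + s) / d\<^sup>2 \<le> (1 + s) / 1"
      using d s2 by (intro divide_left_mono) (auto simp: power2_eq_square mult_ge1_I)
    moreover have "1 - s \<le> (1 + s) / d\<^sup>2"
    proof -
      have "1 - s \<le> 1 / (1 + s)" using s2 by (simp add: divide_simps) (simp add: algebra_simps)
      also have "\<dots> = (1 + s) / (1 + s)\<^sup>2" using s2 by (simp add: power2_eq_square)
      also have "\<dots> \<le> (1 + s) / d\<^sup>2" using d s2 by (intro divide_left_mono power_mono mult_pos_pos) auto
      finally show ?thesis .
    qed
    ultimately show ?thesis using s2 by (auto simp: abs_le_iff)
  qed
  ultimately show "\<bar>tilt t p * (1 - tilt t p) - p * (1 - p)\<bar> \<le> p * (1 - p) * (2 * t)"
    using v by (simp only: abs_mult[of "p * (1 - p)"] abs_of_nonneg[OF v]) (rule mult_left_mono)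
qed

text \<open>
  The derivative in \<open>t\<close> of the left-hand side is the quantity bounded in \<open>tilt_mean\<close>.
\<close>

lemma bernoulli_cumulant_bound:
  fixes p t :: real
  assumes p: "0 \<le> p" "p \<le> 1" and t: "0 \<le> t" "t \<le> 1"
  shows "\<bar>ln (1 - p + p * exp t) - p * t - p * (1 - p) * t\<^sup>2 / 2\<bar> \<le> p * (1 - p) * (4 * t^3)"
proof (cases "t = 0")
  case False
  define f where "f = (\<lambda>t. ln (1 - p + p * exp t) - p * t - p * (1 - p) * t\<^sup>2 / 2)"
  have der: "DERIV f u :> tilt u p - p - p * (1 - p) * u" if "0 \<le> u" for u
    using tilt_denominator_ge_1[OF p(1) that] unfolding f_def
    by (auto intro!: derivative_eq_intros simp: tilt_def)
  have "\<exists>u>0. u < t \<and> f t - f 0 = (t - 0) * (tilt u p - p - p * (1 - p) * u)"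
    using False t by (intro MVT2 der) auto
  then obtain u where u: "0 < u" "u < t" "f t - f 0 = (t - 0) * (tilt u p - p - p * (1 - p) * u)"
    by blast
  have "\<bar>f t\<bar> = t * \<bar>tilt u p - p - p * (1 - p) * u\<bar>"
    using u t by (simp add: f_def abs_mult)
  also have "\<dots> \<le> t * (p * (1 - p) * (4 * t\<^sup>2))"
  proof (intro mult_left_mono)
    have "\<bar>tilt u p - p - p * (1 - p) * u\<bar> \<le> p * (1 - p) * (4 * u\<^sup>2)"
      using u t p by (intro tilt_mean) auto
    also have "\<dots> \<le> p * (1 - p) * (4 * t\<^sup>2)"
      using u p by (intro mult_left_mono power_mono) auto
    finally show "\<bar>tilt u p - p - p * (1 - p) * u\<bar> \<le> p * (1 - p) * (4 * t\<^sup>2)" .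
  qed (use t in auto)
  also have "\<dots> = p * (1 - p) * (4 * t^3)" by (simp add: power2_eq_square power3_eq_cube)
  finally show ?thesis by (simp add: f_def)
qed simp

lemma sum_abs_bound:
  fixes f g h :: "'i \<Rightarrow> real"
  assumes "\<And>i. i \<in> I \<Longrightarrow> \<bar>f i\<bar> \<le> v i * c"
  shows "\<bar>sum f I\<bar> \<le> sum v I * c"
  using order_trans[OF sum_abs sum_mono[of I "\<lambda>i. \<bar>f i\<bar>" "\<lambda>i. v i * c"]] assms
  by (simp add: sum_distrib_right)

section \<open>Exponentially weighted tail sums\<close>

lemma geometric_tail_sum:
  fixes r :: real
  assumes "r \<noteq> 1" "i \<le> j"
  shows "(\<Sum>k\<in>{i..<j}. r ^ k) = (r ^ i - r ^ j) / (1 - r)"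
  using assms(2)
proof (induction j rule: dec_induct)
  case (step n)
  have "(r ^ i - r ^ n) / (1 - r) + r ^ n = (r ^ i - r ^ Suc n) / (1 - r)"
    using assms(1) by (simp add: field_simps)
  with step show ?case by simp
qed simp

text \<open>
  This and the next lemma evaluate, up to a factor tending to 1 as \<open>t\<close> tends to 0, the sum
  that is left after the tilt: it is about \<open>1 / t\<close>, and almost all of it comes from a window of
  length \<open>L / t\<close> as soon as \<open>L\<close> is large.
\<close>

lemma exp_tail_sum_le:
  fixes t m :: real
  assumes "0 < t" "0 \<le> m" "finite A" "\<And>k. k \<in> A \<Longrightarrow> m < real k"
  shows "(\<Sum>k\<in>A. exp (- (t * (real k - m)))) \<le> 1 / (1 - exp (- t))"
proof -
  define r where "r = exp (- t)"
  have r: "0 < r" "r < 1" using assms(1) by (auto simp: r_def)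
  define i where "i = nat \<lfloor>m\<rfloor> + 1"
  have i: "m < real i" using assms(2) by (simp add: i_def) linarith
  obtain N where N: "\<And>k. k \<in> A \<Longrightarrow> k < N" 
    using assms(3) by (metis finite_nat_set_iff_bounded)
  define j where "j = max i N"
  have sub: "A \<subseteq> {i..<j}"
  proof
    fix k assume "k \<in> A"
    then have "m < real k" "k < N" using assms(4) N by auto
    then show "k \<in> {i..<j}" using assms(2) unfolding i_def j_def by (auto simp: less_max_iff_disj) linarith
  qed
  have e: "exp (- (t * (real k - m))) = exp (t * m) * r ^ k" for k
    by (simp add: r_def exp_of_nat2_mult[symmetric] exp_add[symmetric] algebra_simps)
  have "(\<Sum>k\<in>A. exp (- (t * (real k - m)))) \<le> (\<Sum>k\<in>{i..<j}. exp (- (t * (real k - m))))"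
    using sub by (intro sum_mono2) auto
  also have "\<dots> = exp (t * m) * ((r ^ i - r ^ j) / (1 - r))"
    unfolding e sum_distrib_left[symmetric] using r by (subst geometric_tail_sum) (auto simp: j_def)
  also have "\<dots> \<le> (exp (t * m) * r ^ i) / (1 - r)"
    using r by (simp add: divide_right_mono mult_left_mono)
  also have "exp (t * m) * r ^ i = exp (- (t * (real i - m)))" by (simp add: e)
  also have "\<dots> \<le> 1" using assms(1) i by simp
  finally show ?thesis using r by (simp add: r_def divide_right_mono)
qed

lemma exp_window_sum_ge:
  fixes t m L :: real
  assumes "0 < t" "0 \<le> m" "0 \<le> L"
  shows "(exp (- t) - exp (- L)) / (1 - exp (- t))
       \<le> (\<Sum>k | m < real k \<and> real k \<le> m + L / t. exp (- (t * (real k - m))))"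
proof -
  define r where "r = exp (- t)"
  have r: "0 < r" "r < 1" using assms(1) by (auto simp: r_def)
  define i where "i = nat \<lfloor>m\<rfloor> + 1"
  define j where "j = nat \<lfloor>m + L / t\<rfloor> + 1"
  have Lt: "0 \<le> L / t" using assms by simp
  have i: "m < real i" "real i \<le> m + 1" using assms(2) by (simp_all add: i_def) linarith+
  have j: "m + L / t < real j" using assms(2) Lt by (simp add: j_def) linarith
  have ij: "i \<le> j" using Lt by (simp add: i_def j_def nat_mono floor_mono)
  have set: "{k. m < real k \<and> real k \<le> m + L / t} = {i..<j}"
    using assms(2) Lt by (auto simp: i_def j_def le_nat_iff less_Suc_eq_le Suc_le_eq) linarith+
  have e: "exp (- (t * (real k - m))) = exp (t * m) * r ^ k" for k
    by (simp add: r_def exp_of_nat2_mult[symmetric] exp_add[symmetric] algebra_simps)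
  have "exp (- t) \<le> exp (t * m) * r ^ i"
    using mult_left_mono[OF i(2), of t] assms(1) unfolding e[symmetric] by (simp add: algebra_simps)
  moreover have "exp (t * m) * r ^ j \<le> exp (- L)"
    using mult_strict_left_mono[OF j assms(1)] assms(1) unfolding e[symmetric] by (simp add: algebra_simps)
  ultimately have "(exp (- t) - exp (- L)) / (1 - r) \<le> (exp (t * m) * r ^ i - exp (t * m) * r ^ j) / (1 - r)"
    using r by (intro divide_right_mono) auto
  also have "\<dots> = exp (t * m) * ((r ^ i - r ^ j) / (1 - r))" by (simp add: algebra_simps)
  also have "\<dots> = (\<Sum>k\<in>{i..<j}. exp (- (t * (real k - m))))"
    unfolding e sum_distrib_left[symmetric] using r ij by (subst geometric_tail_sum) auto
  finally show ?thesis unfolding set r_def .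
qed

section \<open>Moderate deviations of sums of Bernoulli variables\<close>

text \<open>
  The tail above \<open>m = \<mu> + V t\<close>. Tilting by \<open>t\<close> moves the mean of the sum to within
  \<open>4 V t^2\<close> of \<open>m\<close>, and
  \[ P(k) = e^{K - t m} \, e^{-t (k - m)} \, Q(k), \]
  where \<open>Q\<close> is the tilted law, \<open>K\<close> the cumulant generating function of the sum at \<open>t\<close>, and
  \<open>K - t m = - V t^2 / 2\<close> up to \<open>4 V t^3\<close>. The local limit
  theorem bounds \<open>Q(k)\<close> from above for every \<open>k\<close>, and from below by almost the same number for
  \<open>k\<close> in the window of length \<open>L / t\<close> above \<open>m\<close>; what remains are the sums of the preceding
  section.
\<close>

lemma bernoulli_sum_tail_bounds:
  fixes p :: "'i \<Rightarrow> real" and t L :: real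
  assumes "finite I" and p: "\<And>i. i \<in> I \<Longrightarrow> 0 \<le> p i \<and> p i \<le> 1"
    and t: "0 < t" "t \<le> 1 / 4" and V2: "2 \<le> V" and L: "0 \<le> L"
  defines "\<mu> \<equiv> (\<Sum>i\<in>I. p i)"
    and "W \<equiv> (\<Sum>i\<in>I. tilt t (p i) * (1 - tilt t (p i)))"
  assumes V: "V = (\<Sum>i\<in>I. p i * (1 - p i))"
  defines "S \<equiv> (\<Sum>k | k \<le> card I \<and> \<mu> + V * t < real k. coeff (bernoulli_gf I p) k)"
    and "lb \<equiv> exp (- ((L / t + 4 * V * t\<^sup>2)\<^sup>2 / (2 * W))) / sqrt (2 * pi * W) - 50 / W"
  shows "\<bar>W - V\<bar> \<le> V * (2 * t)"
    and "S \<le> exp (- (V * t\<^sup>2 / 2)) * exp (4 * V * t^3) * (1 / sqrt (2 * pi * W) + 50 / W) * (1 / (1 - exp (- t)))"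
    and "0 \<le> lb \<Longrightarrow> exp (- (V * t\<^sup>2 / 2)) * exp (- (4 * V * t^3)) * lb * ((exp (- t) - exp (- L)) / (1 - exp (- t))) \<le> S"
proof -
  define q where "q = (\<lambda>i. tilt t (p i))"
  have t1: "0 \<le> t" "t \<le> 1" using t by auto
  have q: "0 \<le> q i \<and> q i \<le> 1" if "i \<in> I" for i
    using tilt_bounds[of "p i" t] p[OF that] t1 by (simp add: q_def)
  define m where "m = \<mu> + V * t"
  define \<nu> where "\<nu> = (\<Sum>i\<in>I. q i)"
  define K where "K = (\<Sum>i\<in>I. ln (1 - p i + p i * exp t))"
  define d where "d = coeff (bernoulli_gf I q)"
  have V0: "0 \<le> V" using V2 by simp
  have m0: "0 \<le> m" using p V0 t1 by (simp add: m_def \<mu>_def sum_nonneg)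
  have "\<bar>\<Sum>i\<in>I. q i * (1 - q i) - p i * (1 - p i)\<bar> \<le> V * (2 * t)"
    unfolding V q_def using p t1 by (intro sum_abs_bound tilt_variance) auto
  then show WV: "\<bar>W - V\<bar> \<le> V * (2 * t)"
    by (simp add: W_def V q_def sum_subtractf)
  have "V * (2 * t) \<le> V * (1 / 2)" using t V0 by (intro mult_left_mono) auto
  with WV V2 have W: "1 \<le> W" by linarith
  have "\<bar>\<Sum>i\<in>I. q i - p i - p i * (1 - p i) * t\<bar> \<le> V * (4 * t\<^sup>2)"
    unfolding V q_def using p t1 by (intro sum_abs_bound tilt_mean) auto
  moreover have "V * t = (\<Sum>i\<in>I. p i * (1 - p i) * t)" unfolding V by (rule sum_distrib_right)
  then have "(\<Sum>i\<in>I. q i - p i - p i * (1 - p i) * t) = \<nu> - m"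
    by (simp add: \<nu>_def m_def \<mu>_def sum_subtractf)
  ultimately have \<nu>m: "\<bar>\<nu> - m\<bar> \<le> 4 * V * t\<^sup>2" by (simp add: mult_ac)
  have "\<bar>\<Sum>i\<in>I. ln (1 - p i + p i * exp t) - p i * t - p i * (1 - p i) * t\<^sup>2 / 2\<bar> \<le> V * (4 * t^3)"
    unfolding V using p t1 by (intro sum_abs_bound bernoulli_cumulant_bound) auto
  moreover have "V * t\<^sup>2 / 2 = (\<Sum>i\<in>I. p i * (1 - p i) * t\<^sup>2 / 2)" "\<mu> * t = (\<Sum>i\<in>I. p i * t)"
    unfolding V \<mu>_def by (simp_all only: sum_distrib_right sum_divide_distrib)
  then have "(\<Sum>i\<in>I. ln (1 - p i + p i * exp t) - p i * t - p i * (1 - p i) * t\<^sup>2 / 2) = K - \<mu> * t - V * t\<^sup>2 / 2"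
    by (simp only: K_def sum_subtractf)
  ultimately have "\<bar>K - \<mu> * t - V * t\<^sup>2 / 2\<bar> \<le> 4 * V * t^3" by (simp add: mult_ac)
  then have K: "- (V * t\<^sup>2 / 2) - 4 * V * t^3 \<le> K - t * m" "K - t * m \<le> - (V * t\<^sup>2 / 2) + 4 * V * t^3"
    by (auto simp: m_def algebra_simps power2_eq_square abs_le_iff)
  have lclt: "\<bar>d k - normal_density \<nu> (sqrt W) (real k)\<bar> \<le> 50 / W" for k
    unfolding d_def \<nu>_def using assms(1) q W by (intro bernoulli_sum_local_limit) (auto simp: W_def q_def)
  have d0: "0 \<le> d k" for k
    unfolding d_def using assms(1) q by (intro coeff_bernoulli_gf_nonneg) auto
  define E where "E = (\<lambda>k. exp (- (t * (real k - m))))"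
  have coeff: "coeff (bernoulli_gf I p) k = exp (K - t * m) * (E k * d k)" for k
  proof -
    have "coeff (bernoulli_gf I p) k = exp (K - t * real k) * d k"
      unfolding K_def d_def q_def using assms(1) p t1 by (intro coeff_bernoulli_gf_tilt) auto
    also have "K - t * real k = (K - t * m) + - (t * (real k - m))" by (simp add: algebra_simps)
    finally show ?thesis by (simp only: exp_add E_def mult.assoc)
  qed
  define A where "A = {k. k \<le> card I \<and> m < real k}"
  have finA: "finite A" unfolding A_def by (rule finite_subset[of _ "{..card I}"]) auto
  have S: "S = exp (K - t * m) * (\<Sum>k\<in>A. E k * d k)"
    unfolding S_def coeff sum_distrib_left[symmetric] A_def m_def ..
  have r: "0 < 1 - exp (- t)" using t by simp
  have sW: "0 < sqrt W" "(sqrt W)\<^sup>2 = W" using W by auto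
  show "S \<le> exp (- (V * t\<^sup>2 / 2)) * exp (4 * V * t^3) * (1 / sqrt (2 * pi * W) + 50 / W) * (1 / (1 - exp (- t)))"
  proof -
    have dk: "d k \<le> 1 / sqrt (2 * pi * W) + 50 / W" for k
    proof -
      have "normal_density \<nu> (sqrt W) (real k) \<le> 1 / sqrt (2 * pi * W) * 1"
        unfolding normal_density_def sW(2) using W by (intro mult_left_mono) auto
      then show ?thesis using lclt[of k] by simp
    qed
    have "(\<Sum>k\<in>A. E k * d k) \<le> (\<Sum>k\<in>A. E k * (1 / sqrt (2 * pi * W) + 50 / W))"
      using dk by (intro sum_mono mult_left_mono) (auto simp: E_def)
    also have "\<dots> = (1 / sqrt (2 * pi * W) + 50 / W) * (\<Sum>k\<in>A. E k)"
      by (simp only: sum_distrib_right[symmetric] mult.commute)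
    also have "\<dots> \<le> (1 / sqrt (2 * pi * W) + 50 / W) * (1 / (1 - exp (- t)))"
      unfolding E_def using t m0 finA W by (intro mult_left_mono exp_tail_sum_le) (auto simp: A_def)
    finally have "S \<le> exp (K - t * m) * ((1 / sqrt (2 * pi * W) + 50 / W) * (1 / (1 - exp (- t))))"
      unfolding S by (intro mult_left_mono) auto
    also have "\<dots> \<le> exp (- (V * t\<^sup>2 / 2) + 4 * V * t^3) * ((1 / sqrt (2 * pi * W) + 50 / W) * (1 / (1 - exp (- t))))"
      using K W r by (intro mult_right_mono) auto
    finally show ?thesis unfolding exp_add mult.assoc .
  qed
  show "exp (- (V * t\<^sup>2 / 2)) * exp (- (4 * V * t^3)) * lb * ((exp (- t) - exp (- L)) / (1 - exp (- t))) \<le> S"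
    if lb0: "0 \<le> lb"
  proof -
    define J where "J = {k. m < real k \<and> real k \<le> m + L / t}"
    have finJ: "finite J"
      unfolding J_def by (rule finite_subset[of _ "{..nat \<lfloor>m + L / t\<rfloor>}"]) (auto simp: le_nat_floor)
    have dk: "lb \<le> d k" if "k \<in> J" for k
    proof -
      have "\<bar>real k - \<nu>\<bar> \<le> L / t + 4 * V * t\<^sup>2"
        using that \<nu>m unfolding J_def by (auto simp: abs_le_iff)
      then have "(real k - \<nu>)\<^sup>2 \<le> (L / t + 4 * V * t\<^sup>2)\<^sup>2"
        by (metis abs_ge_zero power2_abs power_mono)
      then have "exp (- ((L / t + 4 * V * t\<^sup>2)\<^sup>2 / (2 * W))) / sqrt (2 * pi * W) \<le> normal_density \<nu> (sqrt W) (real k)"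
        unfolding normal_density_def sW(2) using W by (simp add: divide_right_mono)
      then show ?thesis using lclt[of k] by (simp add: lb_def abs_le_iff)
    qed
    have "lb * ((exp (- t) - exp (- L)) / (1 - exp (- t))) \<le> lb * (\<Sum>k\<in>J. E k)"
      unfolding E_def J_def using t m0 L lb0 by (intro mult_left_mono exp_window_sum_ge) auto
    also have "\<dots> = (\<Sum>k\<in>J. E k * lb)"
      by (simp add: sum_distrib_left mult.commute)
    also have "\<dots> \<le> (\<Sum>k\<in>J. E k * d k)"
      using dk by (intro sum_mono mult_left_mono) (auto simp: E_def)
    \<comment> \<open>the window may reach beyond the number of trials, where the coefficients vanish\<close>
    also have "\<dots> = (\<Sum>k\<in>J \<inter> A. E k * d k)"
    proof (rule sum.mono_neutral_right[OF finJ])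
      show "\<forall>k\<in>J - J \<inter> A. E k * d k = 0"
      proof
        fix k assume "k \<in> J - J \<inter> A"
        then have "degree (bernoulli_gf I q) < k"
          using degree_bernoulli_gf[OF assms(1), of q] by (auto simp: J_def A_def)
        then show "E k * d k = 0" by (simp add: d_def coeff_eq_0)
      qed
    qed auto
    also have "\<dots> \<le> (\<Sum>k\<in>A. E k * d k)"
      using finA d0 by (intro sum_mono2) (auto simp: E_def)
    finally have le: "lb * ((exp (- t) - exp (- L)) / (1 - exp (- t))) \<le> (\<Sum>k\<in>A. E k * d k)" .
    have Apos: "0 \<le> (\<Sum>k\<in>A. E k * d k)" using d0 by (intro sum_nonneg) (auto simp: E_def)
    have "exp (- (V * t\<^sup>2 / 2) + - (4 * V * t^3)) * (lb * ((exp (- t) - exp (- L)) / (1 - exp (- t))))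
        \<le> exp (- (V * t\<^sup>2 / 2) + - (4 * V * t^3)) * (\<Sum>k\<in>A. E k * d k)"
      using le by (intro mult_left_mono) auto
    also have "\<dots> \<le> S"
      unfolding S using K Apos by (intro mult_right_mono) auto
    finally show ?thesis unfolding exp_add mult.assoc .
  qed
qed

text \<open>
  Chosen so that the integrand has the elementary primitive \<open>- \<phi>(u) / u\<close> while being squeezed
  between \<open>\<phi>(u)\<close> and \<open>(1 + 1 / x^2) \<phi>(u)\<close> on \<open>[x, \<infinity>)\<close>. Both bounds on the Mills ratio of the
  normal distribution come from this one integral.
\<close>

lemma std_normal_tail_integral:
  fixes x :: real
  assumes "0 < x"
  shows "(\<integral>\<^sup>+u. ennreal (std_normal_density u * (1 + 1 / u\<^sup>2)) * indicator {x..} u \<partial>lborel)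
       = ennreal (std_normal_density x / x)"
proof -
  have "(\<integral>\<^sup>+u. ennreal (std_normal_density u * (1 + 1 / u\<^sup>2)) * indicator {x..} u \<partial>lborel)
      = ennreal (0 - (- (std_normal_density x / x)))"
  proof (rule nn_integral_FTC_atLeast[where F="\<lambda>u. - (std_normal_density u / u)"])
    fix u :: real assume "x \<le> u"
    then show "DERIV (\<lambda>u. - (std_normal_density u / u)) u :> std_normal_density u * (1 + 1 / u\<^sup>2)"
    proof -
      define c where "c = sqrt (2 * pi)"
      have c: "c \<noteq> 0" by (simp add: c_def)
      have "std_normal_density = (\<lambda>u. exp (- u\<^sup>2 / 2) / c)"
        by (rule ext) (simp add: normal_density_def c_def)
      then show ?thesis using assms \<open>x \<le> u\<close> c
        by (auto intro!: derivative_eq_intros simp: field_simps power2_eq_square)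
    qed
  next
    have "((\<lambda>u::real. - (exp (- u\<^sup>2 / 2) / sqrt (2 * pi) / u)) \<longlongrightarrow> 0) at_top"
      by real_asymp
    then show "((\<lambda>u. - (std_normal_density u / u)) \<longlongrightarrow> 0) at_top"
      by (simp add: normal_density_def)
  qed auto
  then show ?thesis by simp
qed

lemma one_minus_cdf_std_normal:
  fixes x :: real
  shows "ennreal (1 - cdf std_normal_distribution x) 
       = (\<integral>\<^sup>+u. ennreal (std_normal_density u) * indicator {x..} u \<partial>lborel)"
proof -
  interpret N: prob_space std_normal_distribution
    by (rule prob_space_normal_density) simp
  have "1 - cdf std_normal_distribution x = N.prob {x<..}"
    unfolding cdf_def using N.prob_compl[of "{..x}"] by (simp add: Compl_eq_Diff_UNIV[symmetric])
  also have "ennreal \<dots> = emeasure (density lborel std_normal_density) {x<..}"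
    by (rule N.emeasure_eq_measure[symmetric])
  also have "\<dots> = (\<integral>\<^sup>+u. ennreal (std_normal_density u) * indicator {x<..} u \<partial>lborel)"
    by (rule emeasure_density) auto
  also have "\<dots> = (\<integral>\<^sup>+u. ennreal (std_normal_density u) * indicator {x..} u \<partial>lborel)"
    using AE_lborel_singleton[of x] 
    by (intro nn_integral_cong_AE) (auto simp: indicator_def elim!: eventually_mono)
  finally show ?thesis .
qed

lemma mills_ratio_bounds:
  fixes x :: real
  assumes "0 < x"
  shows "1 - cdf std_normal_distribution x \<le> std_normal_density x / x"
    and "std_normal_density x / x \<le> (1 + 1 / x\<^sup>2) * (1 - cdf std_normal_distribution x)"
proof -
  let ?Q = "1 - cdf std_normal_distribution x"
  interpret N: prob_space std_normal_distribution
    by (rule prob_space_normal_density) simp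
  have Q: "0 \<le> ?Q" unfolding cdf_def by simp
  have "ennreal ?Q \<le> ennreal (std_normal_density x / x)"
    unfolding one_minus_cdf_std_normal std_normal_tail_integral[OF assms, symmetric]
    by (intro nn_integral_mono mult_right_mono ennreal_leI) (auto simp: algebra_simps)
  then show "?Q \<le> std_normal_density x / x" using assms by simp
  have "ennreal (std_normal_density x / x) 
      \<le> (\<integral>\<^sup>+u. ennreal (1 + 1 / x\<^sup>2) * (ennreal (std_normal_density u) * indicator {x..} u) \<partial>lborel)"
    unfolding std_normal_tail_integral[OF assms, symmetric]
  proof (rule nn_integral_mono)
    fix u :: real
    show "ennreal (std_normal_density u * (1 + 1 / u\<^sup>2)) * indicator {x..} u
       \<le> ennreal (1 + 1 / x\<^sup>2) * (ennreal (std_normal_density u) * indicator {x..} u)"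
    proof (cases "x \<le> u")
      case True
      have "1 / u\<^sup>2 \<le> 1 / x\<^sup>2" using True assms by (intro divide_left_mono power_mono mult_pos_pos) auto
      then have "std_normal_density u * (1 + 1 / u\<^sup>2) \<le> (1 + 1 / x\<^sup>2) * std_normal_density u"
        by (simp add: mult.commute mult_left_mono)
      then have "ennreal (std_normal_density u * (1 + 1 / u\<^sup>2)) \<le> ennreal ((1 + 1 / x\<^sup>2) * std_normal_density u)"
        by (rule ennreal_leI)
      then show ?thesis using True by (simp add: ennreal_mult' del: ennreal_plus)
    qed simp
  qed
  also have "\<dots> = ennreal (1 + 1 / x\<^sup>2) * ennreal ?Q"
    unfolding one_minus_cdf_std_normal by (rule nn_integral_cmult) auto
  also have "\<dots> = ennreal ((1 + 1 / x\<^sup>2) * ?Q)"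
    using Q by (simp add: ennreal_mult)
  finally show "std_normal_density x / x \<le> (1 + 1 / x\<^sup>2) * ?Q" using Q by simp
qed

lemma mills_ratio_limit:
  "((\<lambda>x. (std_normal_density x / x) / (1 - cdf std_normal_distribution x)) \<longlongrightarrow> 1) at_top"
proof (rule tendsto_sandwich)
  have pos: "0 < 1 - cdf std_normal_distribution x" if "0 < x" for x
  proof -
    have "0 < std_normal_density x / x" using that by (simp add: normal_density_pos)
    also have "\<dots> \<le> (1 + 1 / x\<^sup>2) * (1 - cdf std_normal_distribution x)" by (rule mills_ratio_bounds[OF that])
    finally show ?thesis
      using that by (simp add: zero_less_mult_iff add_pos_nonneg not_less)
        (smt (verit) zero_le_divide_1_iff zero_le_power2)
  qed
  show "\<forall>\<^sub>F x in at_top. 1 \<le> (std_normal_density x / x) / (1 - cdf std_normal_distribution x)"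
    using eventually_gt_at_top[of 0]
    by eventually_elim (use pos mills_ratio_bounds(1) in \<open>auto simp: pos_le_divide_eq mult.commute\<close>)
  show "\<forall>\<^sub>F x in at_top. (std_normal_density x / x) / (1 - cdf std_normal_distribution x) \<le> 1 + 1 / x\<^sup>2"
    using eventually_gt_at_top[of 0]
    by eventually_elim (use pos mills_ratio_bounds(2) in \<open>auto simp: pos_divide_le_eq mult_ac\<close>)
  show "((\<lambda>x::real. 1 + 1 / x\<^sup>2) \<longlongrightarrow> 1) at_top" by real_asymp
qed simp

lemma tendsto_x_over_one_minus_exp:
  "((\<lambda>t::real. t / (1 - exp (- t))) \<longlongrightarrow> 1) (at_right 0)"
  by real_asymp

text \<open>
  The tail bounds with \<open>t = x / sqrt V\<close> and \<open>L = sqrt x\<close>. Then \<open>V t^2 = x^2\<close> and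
  \<open>V t^3 = x^3 / sqrt V \<rightarrow> 0\<close>, so the exponential prefactor is \<open>exp (- x^2 / 2 + o(1))\<close>. The choice of
  \<open>L\<close> makes the window carry all of the exponential sum (\<open>L \<rightarrow> \<infinity>\<close>), while it stays short
  compared with the standard deviation (\<open>L / t = sqrt V / sqrt x\<close>), so that the normal density is
  flat on it. The tail is therefore asymptotic to \<open>\<phi>(x) / x\<close>, and so is \<open>1 - \<Phi>(x)\<close>.
\<close>

theorem bernoulli_sum_moderate_deviation:
  fixes F :: "'n filter" and I :: "'n \<Rightarrow> 'i set" and p :: "'n \<Rightarrow> 'i \<Rightarrow> real" and x V :: "'n \<Rightarrow> real"
  assumes fin: "\<forall>\<^sub>F n in F. finite (I n)"
    and p: "\<forall>\<^sub>F n in F. \<forall>i\<in>I n. 0 \<le> p n i \<and> p n i \<le> 1"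
    and V: "\<forall>\<^sub>F n in F. V n = (\<Sum>i\<in>I n. p n i * (1 - p n i))"
    and V_lim: "filterlim V at_top F" and x_lim: "filterlim x at_top F"
    and small: "((\<lambda>n. x n ^ 3 / sqrt (V n)) \<longlongrightarrow> 0) F"
  shows "((\<lambda>n. (\<Sum>k | k \<le> card (I n) \<and> (\<Sum>i\<in>I n. p n i) + sqrt (V n) * x n < real k. coeff (bernoulli_gf (I n) (p n)) k)
            / (1 - cdf std_normal_distribution (x n))) \<longlongrightarrow> 1) F"
proof -
  define t where "t = (\<lambda>n. x n / sqrt (V n))"
  define S where "S = (\<lambda>n. (\<Sum>k | k \<le> card (I n) \<and> (\<Sum>i\<in>I n. p n i) + sqrt (V n) * x n < real k. coeff (bernoulli_gf (I n) (p n)) k))"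
  define W where "W = (\<lambda>n. (\<Sum>i\<in>I n. tilt (t n) (p n i) * (1 - tilt (t n) (p n i))))"
  \<comment> \<open>ratio of the original to the tilted variance, tending to 1; the bounds below are normalised by it\<close>
  define u where "u = (\<lambda>n. V n / W n)"
  define \<phi> where "\<phi> = (\<lambda>n. std_normal_density (x n))"
  define e where "e = (\<lambda>n. 50 * sqrt (2 * pi) * u n / sqrt (V n))"
  define g where "g = (\<lambda>n. t n / (1 - exp (- t n)))"
  \<comment> \<open>\<open>\<delta>\<close> is the error in the exponent, \<open>D\<close> the largest distance from the window to the tilted mean in units of \<open>sqrt V\<close>\<close>
  define \<delta> where "\<delta> = (\<lambda>n. 4 * (x n ^ 3 / sqrt (V n)))"
  define D where "D = (\<lambda>n. 1 / sqrt (x n) + 4 * (x n ^ 2 / sqrt (V n)))"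
  define lb where "lb = (\<lambda>n. exp (- ((D n)\<^sup>2 * u n / 2)) * sqrt (u n) - e n)"
  have x1: "\<forall>\<^sub>F n in F. 1 \<le> x n" using x_lim by (auto simp: filterlim_at_top)
  have V2: "\<forall>\<^sub>F n in F. 2 \<le> V n" using V_lim by (auto simp: filterlim_at_top)
  have sV: "filterlim (\<lambda>n. sqrt (V n)) at_top F"
    by (rule filterlim_compose[OF sqrt_at_top V_lim])
  \<comment> \<open>eventually \<open>x \<ge> 1\<close>, so smallness of the third power yields that of the lower ones\<close>
  have small_pow: "((\<lambda>n. x n ^ k / sqrt (V n)) \<longlongrightarrow> 0) F" if "k \<le> 3" for k
  proof (rule tendsto_sandwich[OF _ _ tendsto_const small])
    show "\<forall>\<^sub>F n in F. 0 \<le> x n ^ k / sqrt (V n)"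
      using x1 V2 by eventually_elim auto
    show "\<forall>\<^sub>F n in F. x n ^ k / sqrt (V n) \<le> x n ^ 3 / sqrt (V n)"
      using x1 V2 by eventually_elim (auto intro!: divide_right_mono power_increasing that)
  qed
  have t_lim: "(t \<longlongrightarrow> 0) F" using small_pow[of 1] by (simp add: t_def)
  have t_pos: "\<forall>\<^sub>F n in F. 0 < t n" using x1 V2 by eventually_elim (auto simp: t_def)
  have t_small: "\<forall>\<^sub>F n in F. t n < 1 / 4" using t_lim by (rule order_tendstoD) simp
  have props: "\<forall>\<^sub>F n in F. 1 \<le> x n \<and> 2 \<le> V n \<and> x n = t n * sqrt (V n) \<and> \<bar>W n - V n\<bar> \<le> V n * (2 * t n)
     \<and> 0 < W n
     \<and> S n \<le> exp (- (x n ^ 2 / 2)) * exp (\<delta> n) * (1 / sqrt (2 * pi * W n) + 50 / W n) * (1 / (1 - exp (- t n)))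
     \<and> (0 \<le> exp (- ((D n)\<^sup>2 * u n / 2)) / sqrt (2 * pi * W n) - 50 / W n \<longrightarrow>
         exp (- (x n ^ 2 / 2)) * exp (- \<delta> n) * (exp (- ((D n)\<^sup>2 * u n / 2)) / sqrt (2 * pi * W n) - 50 / W n)
           * ((exp (- t n) - exp (- sqrt (x n))) / (1 - exp (- t n))) \<le> S n)"
    using x1 V2 t_pos t_small fin p V
  proof eventually_elim
    case (elim n)
    then have s: "sqrt (V n) > 0" "sqrt (V n) * sqrt (V n) = V n" by auto
    then have xt: "x n = t n * sqrt (V n)" by (simp add: t_def)
    have Vt: "V n * t n = sqrt (V n) * x n" using s unfolding xt by (simp add: mult_ac)
    have Vt2: "V n * (t n)\<^sup>2 = x n ^ 2" using s unfolding xt by (simp add: power2_eq_square mult_ac)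
    have Vt3: "V n * t n ^ 3 = x n ^ 3 / sqrt (V n)"
      using s unfolding xt by (simp add: power3_eq_cube mult_ac)
    have bound: "\<bar>W n - V n\<bar> \<le> V n * (2 * t n)"
      unfolding W_def using elim by (intro bernoulli_sum_tail_bounds(1)[where L="sqrt (x n)"]) auto
    have "V n * (2 * t n) \<le> V n * (1 / 2)" using elim by (intro mult_left_mono) auto
    with bound elim have W: "0 < W n" by linarith
    have DD: "(sqrt (x n) / t n + 4 * V n * (t n)\<^sup>2)\<^sup>2 / (2 * W n) = (D n)\<^sup>2 * u n / 2"
    proof -
      have "sqrt (x n) / t n = sqrt (V n) * (1 / sqrt (x n))"
        using elim s unfolding t_def by (simp add: real_div_sqrt field_simps)
      moreover have "4 * V n * (t n)\<^sup>2 = sqrt (V n) * (4 * (x n ^ 2 / sqrt (V n)))"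
        using s by (simp add: mult.assoc Vt2)
      ultimately have "sqrt (x n) / t n + 4 * V n * (t n)\<^sup>2 = sqrt (V n) * D n"
        unfolding D_def by (simp add: distrib_left)
      then show ?thesis using s by (simp add: u_def power_mult_distrib mult.commute)
    qed
    have S_eq: "S n = (\<Sum>k | k \<le> card (I n) \<and> (\<Sum>i\<in>I n. p n i) + V n * t n < real k. coeff (bernoulli_gf (I n) (p n)) k)"
      by (simp only: S_def Vt)
    have up: "S n \<le> exp (- (V n * (t n)\<^sup>2 / 2)) * exp (4 * V n * t n ^ 3) * (1 / sqrt (2 * pi * W n) + 50 / W n) * (1 / (1 - exp (- t n)))"
      unfolding S_eq W_def using elim by (intro bernoulli_sum_tail_bounds(2)[where L="sqrt (x n)"]) auto
    have lo: "exp (- (V n * (t n)\<^sup>2 / 2)) * exp (- (4 * V n * t n ^ 3)) * 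
       (exp (- ((sqrt (x n) / t n + 4 * V n * (t n)\<^sup>2)\<^sup>2 / (2 * W n))) / sqrt (2 * pi * W n) - 50 / W n)
       * ((exp (- t n) - exp (- sqrt (x n))) / (1 - exp (- t n))) \<le> S n"
      if "0 \<le> exp (- ((sqrt (x n) / t n + 4 * V n * (t n)\<^sup>2)\<^sup>2 / (2 * W n))) / sqrt (2 * pi * W n) - 50 / W n"
      unfolding S_eq W_def using elim that
      by (intro bernoulli_sum_tail_bounds(3)[where L="sqrt (x n)"]) (auto simp: W_def)
    have V3: "4 * V n * t n ^ 3 = \<delta> n" by (simp add: \<delta>_def mult.assoc Vt3)
    from elim(1,2) xt bound W up[unfolded Vt2 V3] lo[unfolded DD Vt2 V3] show ?case by blast
  qed
  have WV: "((\<lambda>n. W n / V n) \<longlongrightarrow> 1) F"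
  proof (rule Lim_transform[OF tendsto_const])
    show "((\<lambda>n. W n / V n - 1) \<longlongrightarrow> 0) F"
    proof (rule Lim_null_comparison)
      show "\<forall>\<^sub>F n in F. norm (W n / V n - 1) \<le> 2 * t n"
        using props
      proof eventually_elim
        case (elim n)
        then have "W n / V n - 1 = (W n - V n) / V n" by (auto simp: diff_divide_distrib)
        with elim show ?case by (auto simp: abs_divide divide_le_eq mult.commute)
      qed
      show "((\<lambda>n. 2 * t n) \<longlongrightarrow> 0) F" using tendsto_mult_right_zero[OF t_lim] by simp
    qed
  qed
  have u_lim: "(u \<longlongrightarrow> 1) F"
    using tendsto_inverse[OF WV] by (simp add: u_def inverse_eq_divide)
  have e_lim: "(e \<longlongrightarrow> 0) F"
    unfolding e_def using u_lim sV
    by (intro tendsto_divide_0[OF tendsto_mult[OF tendsto_const]] filterlim_at_top_imp_at_infinity)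
  have g_lim: "(g \<longlongrightarrow> 1) F"
    unfolding g_def using t_lim t_pos
    by (intro filterlim_compose[OF tendsto_x_over_one_minus_exp]) (auto simp: filterlim_at eventually_conj_iff elim: eventually_mono)
  have \<delta>_lim: "(\<delta> \<longlongrightarrow> 0) F"
    unfolding \<delta>_def using tendsto_mult_right_zero[OF small] by simp
  have "((\<lambda>n. 1 / sqrt (x n)) \<longlongrightarrow> 0) F"
    by (intro tendsto_divide_0[OF tendsto_const] filterlim_at_top_imp_at_infinity filterlim_compose[OF sqrt_at_top x_lim])
  from tendsto_add[OF this tendsto_mult_right_zero[OF small_pow[of 2], of 4]]
  have D_lim: "(D \<longlongrightarrow> 0) F" by (simp add: D_def)
  have D2: "((\<lambda>n. exp (- ((D n)\<^sup>2 * u n / 2))) \<longlongrightarrow> exp (- (0\<^sup>2 * 1 / 2))) F"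
    by (intro tendsto_intros D_lim u_lim) simp
  have lb_lim: "(lb \<longlongrightarrow> 1) F"
    unfolding lb_def
    using tendsto_diff[OF tendsto_mult[OF D2 tendsto_real_sqrt[OF u_lim]] e_lim] by simp
  have window: "((\<lambda>n. exp (- t n) - exp (- sqrt (x n))) \<longlongrightarrow> 1) F"
  proof -
    have "((\<lambda>n. exp (- sqrt (x n))) \<longlongrightarrow> 0) F"
      by (intro filterlim_compose[OF exp_at_bot] filterlim_compose[OF filterlim_uminus_at_bot_at_top]
           filterlim_compose[OF sqrt_at_top x_lim])
    from tendsto_diff[OF tendsto_exp[OF tendsto_minus[OF t_lim]] this] show ?thesis by simp
  qed
  have lb_pos: "\<forall>\<^sub>F n in F. 0 < lb n" using lb_lim by (rule order_tendstoD) simp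
  have "((\<lambda>n. S n / (\<phi> n / x n)) \<longlongrightarrow> 1) F"
  proof (rule tendsto_sandwich)
    show "\<forall>\<^sub>F n in F. exp (- \<delta> n) * lb n * (g n * (exp (- t n) - exp (- sqrt (x n)))) \<le> S n / (\<phi> n / x n)"
      using props lb_pos
    proof eventually_elim
      case (elim n)
      define c where "c = sqrt (2 * pi)"
      have c: "c > 0" by (simp add: c_def)
      define l where "l = exp (- ((D n)\<^sup>2 * u n / 2)) / sqrt (2 * pi * W n) - 50 / W n"
      have s: "sqrt (V n) > 0" "sqrt (V n) * sqrt (V n) = V n" "sqrt (W n) > 0" using elim by auto
      have ue: "sqrt (u n) = sqrt (V n) / sqrt (W n)" "e n = c * sqrt (V n) * (50 / W n)"
        "sqrt (2 * pi * W n) = c * sqrt (W n)"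
      proof -
        show "sqrt (u n) = sqrt (V n) / sqrt (W n)" by (simp add: u_def real_sqrt_divide)
        show "sqrt (2 * pi * W n) = c * sqrt (W n)" by (simp only: c_def real_sqrt_mult)
        have u: "u n = sqrt (V n) * sqrt (V n) / W n" unfolding u_def s(2) ..
        have "50 * c * (a * a / w) / a = c * a * (50 / w)" if "a > 0" for a w :: real using that by simp
        from this[OF s(1)] show "e n = c * sqrt (V n) * (50 / W n)"
          unfolding e_def u c_def[symmetric] .
      qed
      have l: "lb n = c * sqrt (V n) * l"
        using s c unfolding lb_def l_def ue by (simp add: right_diff_distrib)
      have "0 < c * sqrt (V n)" using c s by simp
      then have "0 \<le> l" using elim(2) unfolding l by (metis less_imp_le zero_less_mult_pos)
      then have "exp (- (x n ^ 2 / 2)) * exp (- \<delta> n) * l * ((exp (- t n) - exp (- sqrt (x n))) / (1 - exp (- t n))) \<le> S n"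
        using elim unfolding l_def by blast
      then have "(c * x n / exp (- (x n ^ 2 / 2))) * (exp (- (x n ^ 2 / 2)) * exp (- \<delta> n) * l * ((exp (- t n) - exp (- sqrt (x n))) / (1 - exp (- t n))))
          \<le> (c * x n / exp (- (x n ^ 2 / 2))) * S n"
        using elim c by (intro mult_left_mono) auto
      also have "\<dots> = S n / (\<phi> n / x n)"
        by (simp add: \<phi>_def normal_density_def c_def)
      also have "(c * x n / exp (- (x n ^ 2 / 2))) * (exp (- (x n ^ 2 / 2)) * exp (- \<delta> n) * l * ((exp (- t n) - exp (- sqrt (x n))) / (1 - exp (- t n))))
         = exp (- \<delta> n) * lb n * (g n * (exp (- t n) - exp (- sqrt (x n))))"
      proof -
        have xt: "x n = t n * sqrt (V n)" using elim by blast
        have "(c * X / E) * (E * d * l * (w / r)) = d * (c * s * l) * (t' / r * w)"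
          if "X = t' * s" "E > 0" for X E d l w r t' s :: real
          using that by simp
        from this[OF xt exp_gt_zero] show ?thesis unfolding l g_def .
      qed
      finally show ?case .
    qed
    show "\<forall>\<^sub>F n in F. S n / (\<phi> n / x n) \<le> exp (\<delta> n) * (sqrt (u n) + e n) * g n"
      using props
    proof eventually_elim
      case (elim n)
      define c where "c = sqrt (2 * pi)"
      have c: "c > 0" by (simp add: c_def)
      define l where "l = 1 / sqrt (2 * pi * W n) + 50 / W n"
      have s: "sqrt (V n) > 0" "sqrt (V n) * sqrt (V n) = V n" "sqrt (W n) > 0" using elim by auto
      have ue: "sqrt (u n) = sqrt (V n) / sqrt (W n)" "e n = c * sqrt (V n) * (50 / W n)"
        "sqrt (2 * pi * W n) = c * sqrt (W n)"
      proof -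
        show "sqrt (u n) = sqrt (V n) / sqrt (W n)" by (simp add: u_def real_sqrt_divide)
        show "sqrt (2 * pi * W n) = c * sqrt (W n)" by (simp only: c_def real_sqrt_mult)
        have u: "u n = sqrt (V n) * sqrt (V n) / W n" unfolding u_def s(2) ..
        have "50 * c * (a * a / w) / a = c * a * (50 / w)" if "a > 0" for a w :: real using that by simp
        from this[OF s(1)] show "e n = c * sqrt (V n) * (50 / W n)"
          unfolding e_def u c_def[symmetric] .
      qed
      have l: "sqrt (u n) + e n = c * sqrt (V n) * l"
        using s c unfolding l_def ue by (simp add: distrib_left)
      have "S n \<le> exp (- (x n ^ 2 / 2)) * exp (\<delta> n) * l * (1 / (1 - exp (- t n)))"
        using elim unfolding l_def by blast
      then have "(c * x n / exp (- (x n ^ 2 / 2))) * S n \<le>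
           (c * x n / exp (- (x n ^ 2 / 2))) * (exp (- (x n ^ 2 / 2)) * exp (\<delta> n) * l * (1 / (1 - exp (- t n))))"
        using elim c by (intro mult_left_mono) auto
      also have "(c * x n / exp (- (x n ^ 2 / 2))) * S n = S n / (\<phi> n / x n)"
        by (simp add: \<phi>_def normal_density_def c_def)
      also have "(c * x n / exp (- (x n ^ 2 / 2))) * (exp (- (x n ^ 2 / 2)) * exp (\<delta> n) * l * (1 / (1 - exp (- t n))))
         = exp (\<delta> n) * (sqrt (u n) + e n) * g n"
      proof -
        have xt: "x n = t n * sqrt (V n)" using elim by blast
        have "(c * X / E) * (E * d * l * (1 / r)) = d * (c * s * l) * (t' / r)"
          if "X = t' * s" "E > 0" for X E d l r t' s :: real
          using that by simp
        from this[OF xt exp_gt_zero] show ?thesis unfolding l g_def .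
      qed
      finally show ?case .
    qed
    show "((\<lambda>n. exp (- \<delta> n) * lb n * (g n * (exp (- t n) - exp (- sqrt (x n))))) \<longlongrightarrow> 1) F"
      using tendsto_mult[OF tendsto_mult[OF tendsto_exp[OF tendsto_minus[OF \<delta>_lim]] lb_lim] tendsto_mult[OF g_lim window]]
      by simp
    show "((\<lambda>n. exp (\<delta> n) * (sqrt (u n) + e n) * g n) \<longlongrightarrow> 1) F"
      using tendsto_mult[OF tendsto_mult[OF tendsto_exp[OF \<delta>_lim] tendsto_add[OF tendsto_real_sqrt[OF u_lim] e_lim]] g_lim]
      by simp
  qed
  from tendsto_mult[OF this filterlim_compose[OF mills_ratio_limit x_lim]]
  have "((\<lambda>n. S n / (\<phi> n / x n) * ((\<phi> n / x n) / (1 - cdf std_normal_distribution (x n)))) \<longlongrightarrow> 1) F"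
    by (simp add: \<phi>_def)
  moreover have "\<forall>\<^sub>F n in F. S n / (\<phi> n / x n) * ((\<phi> n / x n) / (1 - cdf std_normal_distribution (x n)))
      = S n / (1 - cdf std_normal_distribution (x n))"
    using x1
  proof eventually_elim
    case (elim n)
    have "\<phi> n / x n \<noteq> 0" using elim normal_density_pos[of 1 0 "x n"] by (simp add: \<phi>_def)
    then show ?case by (simp only: times_divide_eq_right nonzero_eq_divide_eq simp_thms nonzero_divide_eq_eq divide_divide_eq_left nonzero_mult_div_cancel_right) simp
  qed
  ultimately show ?thesis
    unfolding S_def by (rule Lim_transform_eventually)
qed

section \<open>Sums of two independent binomial variables\<close>

lemma expectation_binomial_distr:
  fixes f :: "nat \<Rightarrow> real"
  assumes "prob_space M" and X: "X \<in> measurable M (count_space UNIV)"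
    and d: "distr M (count_space UNIV) X = measure_pmf (binomial_pmf N p)" and p: "p \<in> {0..1}"
  shows "integrable M (\<lambda>\<omega>. f (X \<omega>))"
    and "integral\<^sup>L M (\<lambda>\<omega>. f (X \<omega>)) = (\<Sum>k\<le>N. Bernstein N k p * f k)"
proof -
  have "integrable (distr M (count_space UNIV) X) f"
    unfolding d using p by (rule integrable_binomial_pmf)
  then show "integrable M (\<lambda>\<omega>. f (X \<omega>))"
    using X by (subst (asm) integrable_distr_eq) auto
  have "integral\<^sup>L M (\<lambda>\<omega>. f (X \<omega>)) = integral\<^sup>L (distr M (count_space UNIV) X) f"
    using X by (subst integral_distr) auto
  also have "\<dots> = (\<Sum>k\<le>N. Bernstein N k p * f k)"
    unfolding d using p by (subst expectation_binomial_pmf') (auto simp: Bernstein_def)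
  finally show "integral\<^sup>L M (\<lambda>\<omega>. f (X \<omega>)) = (\<Sum>k\<le>N. Bernstein N k p * f k)" .
qed

lemma binomial_first_moment: "(\<Sum>k\<le>N. Bernstein N k p * real k) = real N * p"
  using sum_k_Bernstein[of N p] by (simp add: mult.commute)

lemma binomial_central_moment:
  "(\<Sum>k\<le>N. Bernstein N k p * (real k - real N * p)\<^sup>2) = real N * (p * (1 - p))"
proof -
  define c where "c = real N * p"
  have "(\<Sum>k\<le>N. Bernstein N k p * (real k - c)\<^sup>2)
     = (\<Sum>k\<le>N. real k * (real k - 1) * Bernstein N k p + (1 - 2 * c) * (real k * Bernstein N k p) + c\<^sup>2 * Bernstein N k p)"
    by (intro sum.cong refl) (simp add: power2_eq_square algebra_simps)
  also have "\<dots> = real N * (real N - 1) * p\<^sup>2 + (1 - 2 * c) * (real N * p) + c\<^sup>2"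
    by (simp add: sum.distrib sum_distrib_left[symmetric])
  also have "\<dots> = real N * (p * (1 - p))" by (simp add: c_def power2_eq_square algebra_simps)
  finally show ?thesis by (simp add: c_def)
qed

definition two_kinds :: "nat \<Rightarrow> real \<Rightarrow> real \<Rightarrow> nat \<Rightarrow> real" where
  "two_kinds N1 p1 p2 i = (if i < N1 then p1 else p2)"

lemma sum_two_kinds:
  fixes f :: "real \<Rightarrow> real"
  shows "(\<Sum>i<N1 + N2. f (two_kinds N1 p1 p2 i)) = real N1 * f p1 + real N2 * f p2"
proof -
  have "(\<Sum>i<N1 + N2. f (two_kinds N1 p1 p2 i))
     = (\<Sum>i<N1. f (two_kinds N1 p1 p2 i)) + (\<Sum>i=N1..<N1 + N2. f (two_kinds N1 p1 p2 i))"
    by (simp add: lessThan_atLeast0 sum.atLeastLessThan_concat)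
  then show ?thesis by (simp add: two_kinds_def)
qed

lemma coeff_linear_power_Bernstein: "coeff ([:1 - p, p:] ^ N) i = (if i \<le> N then Bernstein N i p else 0)"
  for p :: real
proof (cases "i \<le> N")
  case False
  have "degree ([:1 - p, p:] ^ N) \<le> degree [:1 - p, p:] * N" by (rule degree_power_le)
  also have "\<dots> \<le> N" using mult_right_mono[of "degree [:1 - p, p:]" 1 N] by simp
  finally show ?thesis using False by (simp add: coeff_eq_0)
qed (simp add: coeff_linear_poly_power Bernstein_def)

lemma coeff_bernoulli_gf_two_kinds:
  "coeff (bernoulli_gf {..<N1 + N2} (two_kinds N1 p1 p2)) s
    = (\<Sum>i\<le>s. coeff ([:1 - p1, p1:] ^ N1) i * coeff ([:1 - p2, p2:] ^ N2) (s - i))"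
proof -
  have "bernoulli_gf {..<N1 + N2} (two_kinds N1 p1 p2)
     = (\<Prod>i<N1. [:1 - two_kinds N1 p1 p2 i, two_kinds N1 p1 p2 i:]) * (\<Prod>i=N1..<N1 + N2. [:1 - two_kinds N1 p1 p2 i, two_kinds N1 p1 p2 i:])"
    by (simp add: bernoulli_gf_def lessThan_atLeast0 prod.atLeastLessThan_concat)
  also have "\<dots> = [:1 - p1, p1:] ^ N1 * [:1 - p2, p2:] ^ N2"
    by (simp add: two_kinds_def)
  finally show ?thesis by (simp add: coeff_mult)
qed

lemma binomial_sum_distribution:
  fixes X Y :: "'a \<Rightarrow> nat"
  assumes M: "prob_space M"
    and indep: "prob_space.indep_var M (count_space UNIV) X (count_space UNIV) Y"
    and dX: "distr M (count_space UNIV) X = measure_pmf (binomial_pmf N1 p1)"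
    and dY: "distr M (count_space UNIV) Y = measure_pmf (binomial_pmf N2 p2)"
    and p: "p1 \<in> {0..1}" "p2 \<in> {0..1}"
  defines "Z \<equiv> \<lambda>\<omega>. real (X \<omega>) + real (Y \<omega>)"
  shows "prob_space.expectation M Z = real N1 * p1 + real N2 * p2"
    and "prob_space.variance M Z = real N1 * (p1 * (1 - p1)) + real N2 * (p2 * (1 - p2))"
    and "measure M {\<omega> \<in> space M. a < Z \<omega>}
       = (\<Sum>s | s \<le> N1 + N2 \<and> a < real s. coeff (bernoulli_gf {..<N1 + N2} (two_kinds N1 p1 p2)) s)"
proof -
  interpret prob_space M by (rule M)
  have X: "X \<in> measurable M (count_space UNIV)" and Y: "Y \<in> measurable M (count_space UNIV)"
    using indep by (auto dest: indep_var_rv1 indep_var_rv2)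
  note eX = expectation_binomial_distr[OF M X dX p(1)] and eY = expectation_binomial_distr[OF M Y dY p(2)]
  define \<mu>1 \<mu>2 where "\<mu>1 = real N1 * p1" and "\<mu>2 = real N2 * p2"
  have EX: "expectation (\<lambda>\<omega>. real (X \<omega>)) = \<mu>1" and EY: "expectation (\<lambda>\<omega>. real (Y \<omega>)) = \<mu>2"
    using eX(2)[of real] eY(2)[of real] by (simp_all add: binomial_first_moment \<mu>1_def \<mu>2_def)
  show EZ: "expectation Z = real N1 * p1 + real N2 * p2"
    unfolding Z_def using eX(1)[of real] eY(1)[of real] EX EY by (simp add: \<mu>1_def \<mu>2_def)
  let ?f = "\<lambda>k. real k - \<mu>1" and ?g = "\<lambda>k. real k - \<mu>2"
  have ind: "indep_var borel (?f \<circ> X) borel (?g \<circ> Y)"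
    by (rule indep_var_compose[OF indep]) auto
  have iX: "integrable M (?f \<circ> X)" and iY: "integrable M (?g \<circ> Y)"
    using eX(1)[of ?f] eY(1)[of ?g] by (simp_all add: o_def)
  have "expectation (?f \<circ> X) = 0" using eX(1)[of real] EX by (simp add: o_def prob_space)
  then have cross: "expectation (\<lambda>\<omega>. ?f (X \<omega>) * ?g (Y \<omega>)) = 0"
    using indep_var_lebesgue_integral[OF ind iX iY] by (simp add: o_def)
  have icross: "integrable M (\<lambda>\<omega>. ?f (X \<omega>) * ?g (Y \<omega>))"
    using indep_var_integrable[OF ind iX iY] by (simp add: o_def)
  have "(Z \<omega> - expectation Z)\<^sup>2 = (?f (X \<omega>))\<^sup>2 + (?g (Y \<omega>))\<^sup>2 + 2 * (?f (X \<omega>) * ?g (Y \<omega>))" for \<omega>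
    unfolding EZ unfolding Z_def \<mu>1_def \<mu>2_def by (simp add: power2_eq_square algebra_simps)
  then have "variance Z = expectation (\<lambda>\<omega>. (?f (X \<omega>))\<^sup>2 + (?g (Y \<omega>))\<^sup>2 + 2 * (?f (X \<omega>) * ?g (Y \<omega>)))"
    by simp
  also have "\<dots> = expectation (\<lambda>\<omega>. (?f (X \<omega>))\<^sup>2) + expectation (\<lambda>\<omega>. (?g (Y \<omega>))\<^sup>2)"
    using eX(1)[of "\<lambda>k. (?f k)\<^sup>2"] eY(1)[of "\<lambda>k. (?g k)\<^sup>2"] icross cross by simp
  also have "\<dots> = real N1 * (p1 * (1 - p1)) + real N2 * (p2 * (1 - p2))"
    unfolding eX(2)[of "\<lambda>k. (?f k)\<^sup>2"] eY(2)[of "\<lambda>k. (?g k)\<^sup>2"]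
    by (simp add: \<mu>1_def \<mu>2_def binomial_central_moment)
  finally show "variance Z = real N1 * (p1 * (1 - p1)) + real N2 * (p2 * (1 - p2))" .
  have point: "prob (V -` {i} \<inter> space M) = coeff ([:1 - q, q:] ^ N) i"
    if V: "V \<in> measurable M (count_space UNIV)" 
      and d: "distr M (count_space UNIV) V = measure_pmf (binomial_pmf N q)" and q: "q \<in> {0..1}"
    for V :: "'a \<Rightarrow> nat" and N q i
  proof -
    have "prob (V -` {i} \<inter> space M) = measure (distr M (count_space UNIV) V) {i}"
      using V by (simp add: measure_distr)
    also have "\<dots> = coeff ([:1 - q, q:] ^ N) i"
      unfolding d using q by (simp add: measure_pmf_single coeff_linear_power_Bernstein Bernstein_def)
    finally show ?thesis .
  qed
  \<comment> \<open>the values are split by the exact value of the sum, which the product formula for \<open>(X, Y)\<close> evaluates\<close>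
  define B where "B = (\<lambda>s. {\<omega> \<in> space M. X \<omega> + Y \<omega> = s})"
  have Bm: "B s \<in> events" for s
  proof -
    have "B s = (\<Union>i\<le>s. (X -` {i} \<inter> space M) \<inter> (Y -` {s - i} \<inter> space M))"
      by (auto simp: B_def)
    also have "\<dots> \<in> events"
      using X Y by (intro sets.finite_UN sets.Int measurable_sets[OF X] measurable_sets[OF Y]) auto
    finally show ?thesis .
  qed
  have B: "prob (B s) = coeff (bernoulli_gf {..<N1 + N2} (two_kinds N1 p1 p2)) s" for s
  proof -
    have "B s = (\<Union>i\<le>s. (\<lambda>\<omega>. (X \<omega>, Y \<omega>)) -` ({i} \<times> {s - i}) \<inter> space M)"
      by (auto simp: B_def)
    also have "prob \<dots> = (\<Sum>i\<le>s. prob ((\<lambda>\<omega>. (X \<omega>, Y \<omega>)) -` ({i} \<times> {s - i}) \<inter> space M))"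
    proof (rule finite_measure_finite_Union)
      have "(\<lambda>\<omega>. (X \<omega>, Y \<omega>)) -` ({i} \<times> {s - i}) \<inter> space M = (X -` {i} \<inter> space M) \<inter> (Y -` {s - i} \<inter> space M)" for i
        by auto
      then show "(\<lambda>i. (\<lambda>\<omega>. (X \<omega>, Y \<omega>)) -` ({i} \<times> {s - i}) \<inter> space M) ` {..s} \<subseteq> events"
        by (auto intro!: sets.Int measurable_sets[OF X] measurable_sets[OF Y])
    qed (auto simp: disjoint_family_on_def)
    also have "\<dots> = (\<Sum>i\<le>s. prob (X -` {i} \<inter> space M) * prob (Y -` {s - i} \<inter> space M))"
      by (intro sum.cong refl indep_varD[OF indep]) auto
    finally show ?thesis
      unfolding coeff_bernoulli_gf_two_kinds point[OF X dX p(1)] point[OF Y dY p(2)] .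
  qed
  define A where "A = {s. s \<le> N1 + N2 \<and> a < real s}"
  have finA: "finite A" unfolding A_def by (rule finite_subset[of _ "{..N1 + N2}"]) auto
  have "AE \<omega> in M. X \<omega> \<le> N1" "AE \<omega> in M. Y \<omega> \<le> N2"
  proof -
    have *: "AE \<omega> in M. V \<omega> \<le> N"
      if V: "V \<in> measurable M (count_space UNIV)" 
        and d: "distr M (count_space UNIV) V = measure_pmf (binomial_pmf N q)" and q: "q \<in> {0..1}"
      for V :: "'a \<Rightarrow> nat" and N q
    proof -
      have "AE k in distr M (count_space UNIV) V. k \<le> N"
        unfolding d using q by (auto simp: AE_measure_pmf_iff set_pmf_binomial_eq split: if_splits)
      then show ?thesis using V by (subst (asm) AE_distr_iff) auto
    qed
    show "AE \<omega> in M. X \<omega> \<le> N1" "AE \<omega> in M. Y \<omega> \<le> N2"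
      using *[OF X dX p(1)] *[OF Y dY p(2)] by auto
  qed
  then have "prob {\<omega> \<in> space M. a < Z \<omega>} = prob (\<Union>s\<in>A. B s)"
  proof (intro finite_measure_eq_AE)
    have Zm: "Z \<in> borel_measurable M"
      unfolding Z_def using eX(1)[of real] eY(1)[of real] by (intro borel_measurable_add borel_measurable_integrable)
    then show "{\<omega> \<in> space M. a < Z \<omega>} \<in> events" by measurable
    show "(\<Union>s\<in>A. B s) \<in> events" using finA Bm by auto
    assume "AE \<omega> in M. X \<omega> \<le> N1" "AE \<omega> in M. Y \<omega> \<le> N2"
    then show "AE \<omega> in M. (\<omega> \<in> {\<omega> \<in> space M. a < Z \<omega>}) = (\<omega> \<in> (\<Union>s\<in>A. B s))"
      by eventually_elim (auto simp: A_def B_def Z_def)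
  qed
  also have "\<dots> = (\<Sum>s\<in>A. prob (B s))"
    using finA Bm by (intro finite_measure_finite_Union) (auto simp: disjoint_family_on_def B_def)
  finally show "measure M {\<omega> \<in> space M. a < Z \<omega>}
       = (\<Sum>s | s \<le> N1 + N2 \<and> a < real s. coeff (bernoulli_gf {..<N1 + N2} (two_kinds N1 p1 p2)) s)"
    by (simp add: B A_def)
qed

section \<open>The moderate deviation estimate\<close>

text \<open>
  Of \<open>b\<close> and \<open>n - b\<close> the larger one is at least \<open>n / 2\<close>. This turns the two growth conditions, on
  \<open>b'\<close> and on \<open>n - b'\<close>, into growth of the variance.
\<close>

lemma min_prod_bound:
  fixes b n :: real
  assumes "0 \<le> b" "b \<le> n" "0 < n"
  shows "min b (n - b) / 2 \<le> n * (b / n * (1 - b / n))"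
proof -
  have "n * (b / n * (1 - b / n)) = b * (n - b) / n" using assms by (simp add: field_simps)
  moreover have "min b (n - b) / 2 \<le> b * (n - b) / n"
  proof -
    have "min b (n - b) * (n / 2) \<le> min b (n - b) * max b (n - b)"
      using assms by (intro mult_left_mono) (auto simp: max_def)
    also have "\<dots> = b * (n - b)" by (simp add: min_def max_def mult.commute)
    finally show ?thesis using assms by (simp add: pos_le_divide_eq)
  qed
  ultimately show ?thesis by simp
qed

theorem lemma5p2:
  fixes k :: nat and \<gamma>1 \<gamma>2 c0 :: real and a' b' x :: "nat \<Rightarrow> real"
    and M :: "nat \<Rightarrow> 'a measure" and X Y :: "nat \<Rightarrow> 'a \<Rightarrow> nat"
  defines "N \<equiv> admissible \<gamma>1 \<gamma>2 k"
    and "F \<equiv> adm_filter \<gamma>1 \<gamma>2 k"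
  assumes "0 < k" and "0 < \<gamma>1" and "0 < \<gamma>2"
    and "\<And>n. n \<in> N \<Longrightarrow> 0 \<le> b' n \<and> b' n \<le> a' n \<and> a' n \<le> real n"
    and "0 < c0"
    and "ereal c0 < Liminf F (\<lambda>n. ereal (b' n / a' n))"
    and "Limsup F (\<lambda>n. ereal (b' n / a' n)) \<le> 1"
    and "\<And>n. n \<in> N \<Longrightarrow> prob_space (M n)"
    and "\<And>n. n \<in> N \<Longrightarrow>
           prob_space.indep_var (M n) (count_space UNIV) (X n) (count_space UNIV) (Y n)"
    and "\<And>n. n \<in> N \<Longrightarrow> distr (M n) (count_space UNIV) (X n) =
           measure_pmf (binomial_pmf (nat \<lfloor>\<gamma>1 * real n / real k\<rfloor>) (a' n / real n))"
    and "\<And>n. n \<in> N \<Longrightarrow> distr (M n) (count_space UNIV) (Y n) =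
           measure_pmf (binomial_pmf (nat \<lfloor>\<gamma>2 * real n / real k\<rfloor>) (b' n / real n))"
    and "much_greater F b' (\<lambda>n. ln (real n) ^ 3)"
    and "much_greater F (\<lambda>n. real n - b' n) (\<lambda>n. ln (real n) ^ 3)"
    and "x \<sim>[F] (\<lambda>n. sqrt (2 * ln (real n)))"
  defines "Z \<equiv> \<lambda>n \<omega>. real (X n \<omega>) + real (Y n \<omega>)"
  shows "((\<lambda>n.
           measure (M n) {\<omega> \<in> space (M n).
             Z n \<omega> - prob_space.expectation (M n) (Z n)
               > sqrt (prob_space.variance (M n) (Z n)) * x n}
           / (1 - cdf std_normal_distribution (x n))) \<longlongrightarrow> 1) F"
proof -
  note k = assms(3) and \<gamma> = assms(4,5) and ab = assms(6) and prob = assms(10) and indep = assms(11)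
    and dX = assms(12) and dY = assms(13) and b_large = assms(14) and nb_large = assms(15) and x = assms(16)
  define N1 N2 where "N1 = (\<lambda>n. nat \<lfloor>\<gamma>1 * real n / real k\<rfloor>)" and "N2 = (\<lambda>n. nat \<lfloor>\<gamma>2 * real n / real k\<rfloor>)"
  define p where "p = (\<lambda>n. two_kinds (N1 n) (a' n / real n) (b' n / real n))"
  define I where "I = (\<lambda>n. {..<N1 n + N2 n})"
  define V where "V = (\<lambda>n. real (N1 n) * (a' n / real n * (1 - a' n / real n)) + real (N2 n) * (b' n / real n * (1 - b' n / real n)))"
  have inN: "\<forall>\<^sub>F n in F. n \<in> N"
    unfolding F_def N_def adm_filter_def by (simp add: eventually_inf_principal)
  have F_le: "F \<le> sequentially" unfolding F_def adm_filter_def by simp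
  have n_large: "\<forall>\<^sub>F n in F. 3 \<le> n"
    using F_le eventually_ge_at_top[of 3] by (rule filter_leD)
  have ln_lim: "filterlim (\<lambda>n. ln (real n)) at_top F"
    by (rule filterlim_mono[OF _ order_refl F_le]) real_asymp
  have prob_ab: "a' n / real n \<in> {0..1}" "b' n / real n \<in> {0..1}" "0 < n" if "n \<in> N" for n
    using ab[OF that] that by (auto simp: N_def admissible_def divide_le_eq_1)
  have V_ge: "\<forall>\<^sub>F n in F. \<gamma>2 / (2 * real k) * min (b' n) (real n - b' n) \<le> V n"
    using inN
  proof eventually_elim
    case (elim n)
    have "\<gamma>2 * real n / real k \<in> \<int>" using elim by (simp add: N_def admissible_def)
    then have "real (N2 n) = \<gamma>2 * real n / real k"
      using \<gamma> unfolding N2_def by (auto elim!: Ints_cases)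
    then have "real (N2 n) * (b' n / real n * (1 - b' n / real n)) = \<gamma>2 / real k * (real n * (b' n / real n * (1 - b' n / real n)))"
      by simp
    also have "\<dots> \<ge> \<gamma>2 / real k * (min (b' n) (real n - b' n) / 2)"
      using ab[OF elim] prob_ab[OF elim] \<gamma> by (intro mult_left_mono min_prod_bound) auto
    finally have "\<gamma>2 / (2 * real k) * min (b' n) (real n - b' n) \<le> real (N2 n) * (b' n / real n * (1 - b' n / real n))"
      by simp
    moreover have "0 \<le> real (N1 n) * (a' n / real n * (1 - a' n / real n))"
      using prob_ab[OF elim] by (intro mult_nonneg_nonneg) auto
    ultimately show ?case by (simp add: V_def)
  qed
  \<comment> \<open>the variance of \<open>Y\<close> alone already dominates \<open>(ln n)^3\<close>\<close>
  have ratio: "filterlim (\<lambda>n. V n / ln (real n) ^ 3) at_top F"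
  proof (rule filterlim_at_top_mono)
    have "filterlim (\<lambda>n. min (b' n / ln (real n) ^ 3) ((real n - b' n) / ln (real n) ^ 3)) at_top F"
      using b_large nb_large unfolding much_greater_def filterlim_at_top
      by (auto simp: eventually_conj_iff)
    then show "filterlim (\<lambda>n. \<gamma>2 / (2 * real k) * min (b' n / ln (real n) ^ 3) ((real n - b' n) / ln (real n) ^ 3)) at_top F"
      using k \<gamma> by (intro filterlim_tendsto_pos_mult_at_top[OF tendsto_const]) auto
    show "\<forall>\<^sub>F n in F. \<gamma>2 / (2 * real k) * min (b' n / ln (real n) ^ 3) ((real n - b' n) / ln (real n) ^ 3) \<le> V n / ln (real n) ^ 3"
      using V_ge n_large
    proof eventually_elim
      case (elim n)
      have l: "0 < ln (real n) ^ 3" using elim by simp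
      have "min (b' n / ln (real n) ^ 3) ((real n - b' n) / ln (real n) ^ 3) = min (b' n) (real n - b' n) / ln (real n) ^ 3"
        using l by (simp add: min_def divide_le_cancel)
      then show ?case using divide_right_mono[OF elim(1) less_imp_le[OF l]] by simp
    qed
  qed
  have V_lim: "filterlim V at_top F"
  proof (rule filterlim_at_top_mono[OF ratio])
    show "\<forall>\<^sub>F n in F. V n / ln (real n) ^ 3 \<le> V n"
    proof -
      have "\<forall>\<^sub>F n in F. 1 \<le> ln (real n)" using ln_lim by (auto simp: filterlim_at_top)
      moreover have "\<forall>\<^sub>F n in F. 0 \<le> V n / ln (real n) ^ 3" using ratio by (auto simp: filterlim_at_top)
      ultimately show ?thesis
      proof eventually_elim
        case (elim n)
        then have l: "1 \<le> ln (real n) ^ 3" by (intro one_le_power)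
        then have "0 \<le> V n" using elim by (auto simp: zero_le_divide_iff)
        then have "V n / ln (real n) ^ 3 \<le> V n / 1" using l elim(1) by (intro divide_left_mono) auto
        then show ?case by simp
      qed
    qed
  qed
  have sq_lim: "filterlim (\<lambda>n. sqrt (2 * ln (real n))) at_top F"
    by (intro filterlim_compose[OF sqrt_at_top] filterlim_tendsto_pos_mult_at_top[OF tendsto_const] ln_lim) auto
  have x_lim: "filterlim x at_top F"
    by (rule asymp_equiv_at_top_transfer[OF asymp_equiv_symI[OF x] sq_lim])
  \<comment> \<open>\<open>x^3\<close> is of the order \<open>(ln n)^(3/2)\<close>, the square root of the quantity that the variance dominates\<close>
  have small: "((\<lambda>n. x n ^ 3 / sqrt (V n)) \<longlongrightarrow> 0) F"
  proof -
    have r: "((\<lambda>n. x n / sqrt (2 * ln (real n))) \<longlongrightarrow> 1) F"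
    proof (rule asymp_equivD_strong[OF x])
      show "\<forall>\<^sub>F n in F. x n \<noteq> 0 \<or> sqrt (2 * ln (real n)) \<noteq> 0"
        using n_large by eventually_elim auto
    qed
    have "((\<lambda>n. inverse (sqrt (V n / ln (real n) ^ 3))) \<longlongrightarrow> 0) F"
      by (intro tendsto_inverse_0_at_top filterlim_compose[OF sqrt_at_top ratio])
    from tendsto_mult[OF tendsto_power[OF r, of 3] tendsto_mult_right_zero[OF this, of "sqrt 2 ^ 3"]]
    have "((\<lambda>n. (x n / sqrt (2 * ln (real n))) ^ 3 * (sqrt 2 ^ 3 * inverse (sqrt (V n / ln (real n) ^ 3)))) \<longlongrightarrow> 0) F"
      by simp
    moreover have "\<forall>\<^sub>F n in F. (x n / sqrt (2 * ln (real n))) ^ 3 * (sqrt 2 ^ 3 * inverse (sqrt (V n / ln (real n) ^ 3))) = x n ^ 3 / sqrt (V n)"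
      using n_large
    proof eventually_elim
      case (elim n)
      have "sqrt (ln (real n)) \<noteq> 0" "sqrt 2 \<noteq> (0::real)" using elim by auto
      then show ?case
        by (simp add: real_sqrt_mult real_sqrt_divide real_sqrt_power power_divide power_mult_distrib del: real_sqrt_eq_zero_cancel_iff)
    qed
    ultimately show ?thesis by (rule Lim_transform_eventually)
  qed
  have "((\<lambda>n. (\<Sum>s | s \<le> card (I n) \<and> (\<Sum>i\<in>I n. p n i) + sqrt (V n) * x n < real s. coeff (bernoulli_gf (I n) (p n)) s)
            / (1 - cdf std_normal_distribution (x n))) \<longlongrightarrow> 1) F"
  proof (rule bernoulli_sum_moderate_deviation[OF _ _ _ V_lim x_lim small])
    show "\<forall>\<^sub>F n in F. finite (I n)" by (simp add: I_def)
    show "\<forall>\<^sub>F n in F. \<forall>i\<in>I n. 0 \<le> p n i \<and> p n i \<le> 1"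
      using inN by eventually_elim (use prob_ab in \<open>auto simp: p_def two_kinds_def\<close>)
    show "\<forall>\<^sub>F n in F. V n = (\<Sum>i\<in>I n. p n i * (1 - p n i))"
      by (simp add: V_def I_def p_def sum_two_kinds[of "\<lambda>q. q * (1 - q)"])
  qed
  moreover have "\<forall>\<^sub>F n in F. (\<Sum>s | s \<le> card (I n) \<and> (\<Sum>i\<in>I n. p n i) + sqrt (V n) * x n < real s. coeff (bernoulli_gf (I n) (p n)) s)
            / (1 - cdf std_normal_distribution (x n))
       = measure (M n) {\<omega> \<in> space (M n). Z n \<omega> - prob_space.expectation (M n) (Z n)
               > sqrt (prob_space.variance (M n) (Z n)) * x n}
           / (1 - cdf std_normal_distribution (x n))"
    using inN
  proof eventually_elim
    case (elim n)
    have N: "nat \<lfloor>\<gamma>1 * real n / real k\<rfloor> = N1 n" "nat \<lfloor>\<gamma>2 * real n / real k\<rfloor> = N2 n"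
      by (simp_all add: N1_def N2_def)
    note D = binomial_sum_distribution[OF prob[OF elim] indep[OF elim]
        dX[OF elim, unfolded N] dY[OF elim, unfolded N] prob_ab(1,2)[OF elim]]
    have mean: "(\<Sum>i\<in>I n. p n i) = prob_space.expectation (M n) (Z n)"
      unfolding Z_def D(1) I_def p_def by (rule sum_two_kinds[of "\<lambda>q. q"])
    have var: "V n = prob_space.variance (M n) (Z n)"
      unfolding Z_def D(2) V_def ..
    have "{\<omega> \<in> space (M n). Z n \<omega> - prob_space.expectation (M n) (Z n) > sqrt (prob_space.variance (M n) (Z n)) * x n}
        = {\<omega> \<in> space (M n). prob_space.expectation (M n) (Z n) + sqrt (prob_space.variance (M n) (Z n)) * x n < Z n \<omega>}"
      by (auto simp: algebra_simps)
    then show ?case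
      unfolding mean var using D(3) by (simp add: Z_def I_def p_def)
  qed
  ultimately show ?thesis by (rule Lim_transform_eventually)
qed

end
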